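(* Let $(G,w)$ be a weighted graph with first Betti number $b\ge 1$. Then the unit ball of its stable norm $\|\cdot\|_w$ on $H_1(G,\mathbb R)$ is a $b$-dimensional polytope whose number of vertices is at most $2(2^b-1)$.
   Context: A weighted graph $(G,w)$ is a finite connected non-oriented multigraph $G=(V,E)$ (multiple edges and loops allowed) with a weight function $w:E\to\mathbb R_{+}$, taken to have positive values. It carries the length metric obtained by identifying each edge $e$ with an interval of length $w(e)$. Stable norm: for an integer class $v\in H_1(G,\mathbb R)$ (in the lattice $H_1(G,\mathbb Z)$), $\|v\|_w=\lim_{n\to+\infty} L_w(\gamma_n)/n$, where $\gamma_n$ is a shortest closed curve realizing the class $nv$ and $L_w$ is length. This extends (by homogeneity and continuity) to a norm on $H_1(G,\mathbb R)\cong\mathbb R^b$, the stable norm, whose unit ball is $\{u\in H_1(G,\mathbb R): \|u\|_w\le 1\}$. *)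

theory Defs
  imports "HOL-Complex_Analysis.Complex_Analysis"
begin

text \<open>
  The vertex set and the edge set of a finite multigraph are finite types. The functions
  \<open>src\<close> and \<open>tgt\<close> record the two ends of an edge, in an arbitrary order: the graph is not
  oriented, and curves run along edges in both directions. The order only fixes the sign
  convention for chains and the direction of the arc length parameter \<open>0 \<le> t \<le> weight G e\<close>
  on each edge.
\<close>

record ('v, 'e) wgraph =
  src :: "'e \<Rightarrow> 'v"
  tgt :: "'e \<Rightarrow> 'v"
  weight :: "'e \<Rightarrow> real"

definition adjacency :: "('v, 'e) wgraph \<Rightarrow> ('v \<times> 'v) set" where
  "adjacency G = {(src G e, tgt G e) | e. True} \<union> {(tgt G e, src G e) | e. True}"

definition weighted_graph :: "('v::finite, 'e::finite) wgraph \<Rightarrow> bool" where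
  "weighted_graph G \<longleftrightarrow> (\<forall>e. weight G e > 0) \<and> (\<forall>u v. (u, v) \<in> (adjacency G)\<^sup>*)"


section \<open>Homology\<close>

text \<open>
  Cellular homology of the one-dimensional complex \<open>G\<close>: there are no 2-cells, so \<open>H\<^sub>1\<close> is the
  kernel of the boundary map.
\<close>

definition boundary :: "('v::finite, 'e::finite) wgraph \<Rightarrow> real ^ 'e \<Rightarrow> real ^ 'v" where
  "boundary G c = (\<Sum>e\<in>UNIV. c $ e *\<^sub>R (axis (tgt G e) 1 - axis (src G e) 1))"

definition H1_real :: "('v::finite, 'e::finite) wgraph \<Rightarrow> (real ^ 'e) set" where
  "H1_real G = {c. boundary G c = 0}"

definition H1_int :: "('v::finite, 'e::finite) wgraph \<Rightarrow> (real ^ 'e) set" where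
  "H1_int G = {c \<in> H1_real G. \<forall>e. c $ e \<in> \<int>}"

definition betti1 :: "('v::finite, 'e::finite) wgraph \<Rightarrow> nat" where
  "betti1 G = dim (H1_real G)"


section \<open>The metric graph\<close>

datatype ('v, 'e) point = Vertex 'v | Inner 'e real

definition points :: "('v, 'e) wgraph \<Rightarrow> ('v, 'e) point set" where
  "points G = range Vertex \<union> {Inner e t | e t. 0 < t \<and> t < weight G e}"

definition edge_point :: "('v, 'e) wgraph \<Rightarrow> 'e \<Rightarrow> real \<Rightarrow> ('v, 'e) point" where
  "edge_point G e t =
     (if t = 0 then Vertex (src G e)
      else if t = weight G e then Vertex (tgt G e)
      else Inner e t)"

text \<open>
  \<open>joined G x l y\<close>: the points \<open>x\<close> and \<open>y\<close> are joined by a finite succession of edge segments of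
  total length \<open>l\<close>.
\<close>

inductive joined :: "('v, 'e) wgraph \<Rightarrow> ('v, 'e) point \<Rightarrow> real \<Rightarrow> ('v, 'e) point \<Rightarrow> bool"
  for G where
  refl: "joined G x 0 x"
| step: "joined G (edge_point G e s) (\<bar>s - t\<bar> + l) y"
    if "s \<in> {0..weight G e}" and "t \<in> {0..weight G e}" and "joined G (edge_point G e t) l y"

text \<open>
  The value \<open>0\<close> outside \<open>points G\<close> is there because the locale \<open>Metric_space\<close> requires symmetry
  and nonnegativity of the distance also off the carrier.
\<close>

definition length_metric ::
    "('v, 'e) wgraph \<Rightarrow> ('v, 'e) point \<Rightarrow> ('v, 'e) point \<Rightarrow> real" where
  "length_metric G x y =
     (if x \<in> points G \<and> y \<in> points G then Inf {l. joined G x l y} else 0)"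

definition graph_topology :: "('v, 'e) wgraph \<Rightarrow> ('v, 'e) point topology" where
  "graph_topology G = Metric_space.mtopology (points G) (length_metric G)"


section \<open>Closed curves\<close>

definition closed_curve :: "('v, 'e) wgraph \<Rightarrow> (real \<Rightarrow> ('v, 'e) point) \<Rightarrow> bool" where
  "closed_curve G \<gamma> \<longleftrightarrow> pathin (graph_topology G) \<gamma> \<and> \<gamma> 0 = \<gamma> 1"

definition curve_length :: "('v, 'e) wgraph \<Rightarrow> (real \<Rightarrow> ('v, 'e) point) \<Rightarrow> ennreal" where
  "curve_length G \<gamma> =
     (SUP n::nat. SUP t\<in>{t :: nat \<Rightarrow> real. mono t \<and> range t \<subseteq> {0..1}}.
        ennreal (\<Sum>i<n. length_metric G (\<gamma> (t i)) (\<gamma> (t (Suc i)))))"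

text \<open>
  Collapsing the complement of the open edge \<open>e\<close> to a point turns the graph into a circle. The
  coefficient at \<open>e\<close> of the homology class of a closed curve is the degree of its image there.
\<close>

definition collapse :: "('v, 'e) wgraph \<Rightarrow> 'e \<Rightarrow> ('v, 'e) point \<Rightarrow> complex" where
  "collapse G e p =
     (case p of
        Vertex v \<Rightarrow> 1
      | Inner f t \<Rightarrow> if f = e then cis (2 * pi * t / weight G e) else 1)"

definition homology_class ::
    "('v, 'e::finite) wgraph \<Rightarrow> (real \<Rightarrow> ('v, 'e) point) \<Rightarrow> real ^ 'e" where
  "homology_class G \<gamma> = (\<chi> e. Re (winding_number (collapse G e \<circ> \<gamma>) 0))"


section \<open>The stable norm\<close>

text \<open>
  The length of a shortest closed curve realizing the class \<open>h\<close>; for integer classes the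
  infimum is attained.
\<close>

definition minimal_length :: "('v, 'e::finite) wgraph \<Rightarrow> real ^ 'e \<Rightarrow> ennreal" where
  "minimal_length G h =
     (INF \<gamma>\<in>{\<gamma>. closed_curve G \<gamma> \<and> homology_class G \<gamma> = h}. curve_length G \<gamma>)"

definition stable_norm_int :: "('v, 'e::finite) wgraph \<Rightarrow> real ^ 'e \<Rightarrow> real" where
  "stable_norm_int G v = lim (\<lambda>n. enn2real (minimal_length G (real n *\<^sub>R v)) / real n)"

text \<open>
  The extension to \<open>H1_real G\<close> by homogeneity and continuity. The value \<open>0\<close> elsewhere only serves
  to determine the function.
\<close>

definition stable_norm :: "('v::finite, 'e::finite) wgraph \<Rightarrow> real ^ 'e \<Rightarrow> real" where
  "stable_norm G =
     (THE N. (\<forall>v\<in>H1_int G. N v = stable_norm_int G v)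
           \<and> (\<forall>u\<in>H1_real G. \<forall>c. N (c *\<^sub>R u) = \<bar>c\<bar> * N u)
           \<and> continuous_on (H1_real G) N
           \<and> (\<forall>u. u \<notin> H1_real G \<longrightarrow> N u = 0))"

definition stable_unit_ball :: "('v::finite, 'e::finite) wgraph \<Rightarrow> (real ^ 'e) set" where
  "stable_unit_ball G = {u \<in> H1_real G. stable_norm G u \<le> 1}"

end

theory Submission
  imports Defs
begin

text \<open>
  On cycles the stable norm is the weighted l1 norm \<open>\<Sum> weight e * \<bar>c e\<bar>\<close>; after that the
  claim is about a polytope cut out of the subspace of cycles.

  Lower bound for the length (\<open>curve_length_ge\<close>). Along a closed curve the collapse onto the circle
  of an edge \<open>e\<close> has a continuous argument, whose total variation is at least
  \<open>2 * pi * \<bar>c e\<bar>\<close> for the class \<open>c\<close> of the curve. Small displacements in the length metric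
  control the changes of all these arguments at the same time, each rescaled by
  \<open>weight e / (2 * pi)\<close>, so that summing over a fine partition of the curve gives the l1 norm.

  Upper bound (\<open>curves_in_multiples\<close>). An integer cycle \<open>v\<close> is a flow. Following it from edge to edge
  (\<open>follow_flow\<close>) splits \<open>v\<close> without cancellation into the classes of closed walks, whose
  lengths add up to the l1 norm. A curve in the class \<open>k v\<close> runs \<open>k\<close> times through each of these
  walks; the connecting paths, run to and fro, contribute to its length a constant independent of
  \<open>k\<close> and nothing to its class. Division by \<open>k\<close> gives the stable norm of integer classes, and
  density of the rational classes gives the rest (\<open>stable_norm_eq\<close>).

  Counting vertices (\<open>card_extreme_points_l1_ball\<close>). The combinatorial input is that a cycle with a
  nonintegral coefficient admits a nonzero cycle supported on its nonintegral edges
  (\<open>exists_cycle_supported_in_nonintegral\<close>). It makes up for the choice of a spanning tree: a minimal set \<open>B\<close> of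
  edges whose coefficients determine every cycle has \<open>b\<close> elements, and cycles that are integral on
  \<open>B\<close> are integral. At an extreme point \<open>u\<close> all cycles supported in the support of \<open>u\<close> are multiples
  of \<open>u\<close>, and all nonzero coefficients of \<open>u\<close> have the same absolute value, so that up to
  scaling \<open>u\<close> is a cycle with coefficients \<open>0\<close>, \<open>1\<close> and \<open>- 1\<close>. If the supports of two such cycles
  agree on \<open>B\<close>, then half of their difference is integral on \<open>B\<close>, hence everywhere, so the
  supports agree on all edges and the extreme points are equal or opposite. A pair of opposite
  extreme points is therefore determined by a nonempty subset of the \<open>b\<close>-element set \<open>B\<close>.
\<close>

no_notation fps_nth (infixl "$" 75)

section \<open>Cycles with a prescribed support\<close>

definition half_end :: "('v, 'e) wgraph \<Rightarrow> 'e \<times> bool \<Rightarrow> 'v" where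
  "half_end G h = (if snd h then tgt G (fst h) else src G (fst h))"

lemma boundary_nth:
  "boundary G c $ v = (\<Sum>e\<in>UNIV. c $ e * (of_bool (tgt G e = v) - of_bool (src G e = v)))"
  by (auto simp: boundary_def axis_def sum_component intro!: sum.cong)

lemma boundary_nth_half_ends:
  fixes G :: "('v::finite, 'e::finite) wgraph"
  shows "boundary G c $ v =
    (\<Sum>h\<in>{h. half_end G h = v}. (if snd h then c $ fst h else - (c $ fst h)))"
proof -
  have "(\<Sum>h\<in>{h. half_end G h = v}. (if snd h then c $ fst h else - (c $ fst h))) =
    (\<Sum>h\<in>UNIV \<times> UNIV. if half_end G h = v then (if snd h then c $ fst h else - (c $ fst h)) else 0)"
    by (subst sum.If_cases) (auto simp: UNIV_Times_UNIV)
  also have "\<dots> = (\<Sum>e\<in>UNIV. \<Sum>b\<in>UNIV. if half_end G (e, b) = v then (if b then c $ e else - (c $ e)) else 0)"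
    by (subst sum.cartesian_product) (auto intro!: sum.cong)
  also have "\<dots> = boundary G c $ v"
    unfolding boundary_nth by (auto simp: UNIV_bool half_end_def intro!: sum.cong)
  finally show ?thesis ..
qed

lemma linear_boundary: "linear (boundary G)"
  by (rule linearI) (simp_all add: vec_eq_iff boundary_nth sum.distrib[symmetric] sum_distrib_left algebra_simps)

lemma sum_boundary: "(\<Sum>v\<in>UNIV. boundary G c $ v) = 0"
proof -
  have "(\<Sum>v\<in>UNIV. boundary G c $ v) =
    (\<Sum>e\<in>UNIV. c $ e * (\<Sum>v\<in>UNIV. of_bool (tgt G e = v) - of_bool (src G e = v)))"
    unfolding boundary_nth by (subst sum.swap) (simp add: sum_distrib_left)
  then show ?thesis by (simp add: sum_subtractf of_bool_def)
qed

lemma subspace_H1_real: "subspace (H1_real G)"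
  unfolding H1_real_def using linear_boundary linear_subspace_kernel by blast

lemma H1_real_add: "a \<in> H1_real G \<Longrightarrow> c \<in> H1_real G \<Longrightarrow> a + c \<in> H1_real G"
  and H1_real_diff: "a \<in> H1_real G \<Longrightarrow> c \<in> H1_real G \<Longrightarrow> a - c \<in> H1_real G"
  and H1_real_scale: "c \<in> H1_real G \<Longrightarrow> r *\<^sub>R c \<in> H1_real G"
  and H1_real_zero: "0 \<in> H1_real G"
  and H1_real_sum: "(\<And>i. i \<in> I \<Longrightarrow> f i \<in> H1_real G) \<Longrightarrow> sum f I \<in> H1_real G"
  using subspace_H1_real[of G]
  by (auto simp: subspace_add subspace_diff subspace_scale subspace_0 subspace_sum)

lemma dim_supported_in: "dim {x :: real ^ 'n. \<forall>i. i \<notin> A \<longrightarrow> x $ i = 0} = card A"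
  using dim_substandard_cart[of A, where 'a = real] by (simp add: dim_vec_eq)

lemma subspace_supported_in: "subspace {x :: real ^ 'n. \<forall>i. i \<notin> A \<longrightarrow> x $ i = 0}"
  by (auto simp: subspace_def)

text \<open>
  Let \<open>F\<close> be the set of nonintegral edges and \<open>V\<close> the set of their ends. The boundary vanishes at
  every vertex, so no vertex meets exactly one half edge of \<open>F\<close>; counting half edges gives
  \<open>card V \<le> card F\<close>. The boundaries of chains on \<open>F\<close> live on \<open>V\<close> and have coefficient sum \<open>0\<close>,
  a space of dimension less than \<open>card V\<close>, so the boundary map is not injective on these chains.
\<close>

lemma exists_cycle_supported_in_nonintegral:
  fixes G :: "('v::finite, 'e::finite) wgraph"
  assumes c: "c \<in> H1_real G" and e0: "c $ e0 \<notin> \<int>"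
  obtains z where "z \<in> H1_real G" "z \<noteq> 0" "\<And>e. c $ e \<in> \<int> \<Longrightarrow> z $ e = 0"
proof -
  define F where "F = {e. c $ e \<notin> \<int>}"
  define V where "V = half_end G ` (F \<times> UNIV)"
  have two: "2 \<le> card {h \<in> F \<times> UNIV. half_end G h = v}" if "v \<in> V" for v
  proof (rule ccontr)
    let ?S = "{h \<in> F \<times> UNIV. half_end G h = v}"
    let ?val = "\<lambda>h. if snd h then c $ fst h else - (c $ fst h)"
    assume "\<not> 2 \<le> card ?S"
    moreover from that obtain h where h: "h \<in> ?S" by (auto simp: V_def)
    ultimately have S: "?S = {h}"
      by (metis (no_types, lifting) One_nat_def card_1_singletonE card_gt_0_iff empty_iff finite less_2_cases not_le
          neq0_conv singletonD)
    have "?val h = - (\<Sum>k\<in>{k. half_end G k = v} - {h}. ?val k)"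
    proof -
      have "boundary G c $ v = 0" using c by (simp add: H1_real_def)
      then show ?thesis
        unfolding boundary_nth_half_ends using h by (subst (asm) sum.remove[of _ h]) auto
    qed
    also have "\<dots> \<in> \<int>"
    proof (intro Ints_minus Ints_sum)
      fix k assume k: "k \<in> {k. half_end G k = v} - {h}"
      then have "k \<notin> ?S" using S by blast
      with k have "c $ fst k \<in> \<int>" by (cases k) (auto simp: F_def)
      then show "?val k \<in> \<int>" by auto
    qed
    finally have "c $ fst h \<in> \<int>" by (auto split: if_splits simp: minus_in_Ints_iff)
    then show False using h by (cases h) (auto simp: F_def)
  qed
  have "card V * 2 \<le> (\<Sum>v\<in>V. card {h \<in> F \<times> UNIV. half_end G h = v})"
    using sum_mono[of V "\<lambda>_. 2 :: nat" "\<lambda>v. card {h \<in> F \<times> UNIV. half_end G h = v}"] two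
    by (simp add: mult.commute)
  also have "\<dots> = card (F \<times> (UNIV :: bool set))"
    using sum.group[of "F \<times> (UNIV :: bool set)" V "half_end G" "\<lambda>_. 1 :: nat"] by (simp add: V_def)
  also have "\<dots> = card F * 2" by (simp add: card_cartesian_product)
  finally have VF: "card V \<le> card F" by simp
  let ?R = "{x :: real ^ 'e. \<forall>e. e \<notin> F \<longrightarrow> x $ e = 0}"
  let ?Y = "{y :: real ^ 'v. \<forall>v. v \<notin> V \<longrightarrow> y $ v = 0}"
  let ?W = "{y \<in> ?Y. (\<Sum>v\<in>UNIV. y $ v) = 0}"
  have "boundary G ` ?R \<subseteq> ?W"
  proof -
    have "boundary G x $ v = 0" if "x \<in> ?R" "v \<notin> V" for x v
      unfolding boundary_nth_half_ends
    proof (intro sum.neutral ballI)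
      fix h assume "h \<in> {h. half_end G h = v}"
      with \<open>v \<notin> V\<close> have "fst h \<notin> F" by (cases h) (auto simp: V_def)
      with \<open>x \<in> ?R\<close> show "(if snd h then x $ fst h else - (x $ fst h)) = 0" by simp
    qed
    then show ?thesis by (auto simp: sum_boundary)
  qed
  then have "dim (boundary G ` ?R) \<le> dim ?W" by (rule dim_subset)
  also have "dim ?W < dim ?Y"
  proof (rule dim_psubset)
    have sW: "subspace ?W" using subspace_supported_in[of V]
      by (auto simp: subspace_def sum.distrib sum_distrib_left[symmetric])
    let ?v = "half_end G (e0, True)"
    have "?v \<in> V" using e0 by (auto simp: V_def F_def)
    then have "axis ?v 1 \<in> ?Y" "axis ?v 1 \<notin> ?W" by (auto simp: axis_def)
    then show "span ?W \<subset> span ?Y"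
      using sW subspace_supported_in[of V] by (auto simp: span_eq_iff[THEN iffD2])
  qed
  also have "dim ?Y = card V" by (rule dim_supported_in)
  also have "card V \<le> card F" by (rule VF)
  also have "card F = dim ?R" by (rule dim_supported_in[symmetric])
  finally have "dim (boundary G ` ?R) < dim ?R" .
  then have "\<not> inj_on (boundary G) (span ?R)"
    using dim_image_eq[OF linear_boundary, of G ?R] by auto
  then have "\<not> inj_on (boundary G) ?R"
    using subspace_supported_in[of F] by (simp add: span_eq_iff[THEN iffD2])
  then obtain x where "x \<in> ?R" "boundary G x = 0" "x \<noteq> 0"
    using linear_injective_on_subspace_0[OF linear_boundary subspace_supported_in[of F]] by blast
  then show ?thesis using that[of x] by (auto simp: H1_real_def F_def)
qed

text \<open>
  The complement of a spanning tree is a determining set; more generally, the determining sets are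
  the spanning sets of the dual matroid of the graph.
\<close>

definition determining :: "('v::finite, 'e::finite) wgraph \<Rightarrow> 'e set \<Rightarrow> bool" where
  "determining G B \<longleftrightarrow> (\<forall>z\<in>H1_real G. (\<forall>e\<in>B. z $ e = 0) \<longrightarrow> z = 0)"

lemma determiningD:
  "determining G B \<Longrightarrow> z \<in> H1_real G \<Longrightarrow> (\<And>e. e \<in> B \<Longrightarrow> z $ e = 0) \<Longrightarrow> z = 0"
  by (auto simp: determining_def)

lemma integral_if_integral_on_determining:
  assumes B: "determining G B" and c: "c \<in> H1_real G" and int: "\<And>e. e \<in> B \<Longrightarrow> c $ e \<in> \<int>"
  shows "c \<in> H1_int G"
proof -
  have "c $ e \<in> \<int>" for e
  proof (rule ccontr)
    assume "c $ e \<notin> \<int>"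
    then obtain z where "z \<in> H1_real G" "z \<noteq> 0" "\<And>e. c $ e \<in> \<int> \<Longrightarrow> z $ e = 0"
      using exists_cycle_supported_in_nonintegral[OF c] by blast
    then show False using determiningD[OF B] int by blast
  qed
  then show ?thesis using c by (simp add: H1_int_def)
qed

text \<open>
  The cycles \<open>\<zeta> b\<close> are dual to the coordinates in \<open>B\<close>, like the fundamental cycles of a spanning
  tree with complement \<open>B\<close>.
\<close>

definition cycle_basis ::
    "('v::finite, 'e::finite) wgraph \<Rightarrow> 'e set \<Rightarrow> ('e \<Rightarrow> real ^ 'e) \<Rightarrow> bool" where
  "cycle_basis G B \<zeta> \<longleftrightarrow> determining G B \<and>
     (\<forall>b\<in>B. \<zeta> b \<in> H1_int G \<and> (\<forall>e\<in>B. \<zeta> b $ e = of_bool (e = b)))"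

text \<open>
  In a determining set of least cardinality no edge \<open>b\<close> can be spared, so there is a cycle that
  vanishes on the other edges of the set but not at \<open>b\<close>.
\<close>

lemma exists_cycle_basis:
  fixes G :: "('v::finite, 'e::finite) wgraph"
  obtains B \<zeta> where "cycle_basis G B \<zeta>"
proof -
  have "determining G UNIV" by (auto simp: determining_def vec_eq_iff)
  then obtain B where B: "determining G B" and least: "\<And>C. determining G C \<Longrightarrow> card B \<le> card C"
    using ex_has_least_nat[of "determining G" UNIV card] by blast
  have "\<exists>z. z \<in> H1_int G \<and> (\<forall>e\<in>B. z $ e = of_bool (e = b))" if b: "b \<in> B" for b
  proof -
    have "card (B - {b}) < card B" using b by (intro psubset_card_mono) auto
    then have "\<not> determining G (B - {b})" using least by force
    then obtain z where z: "z \<in> H1_real G" "z \<noteq> 0" "\<And>e. e \<in> B - {b} \<Longrightarrow> z $ e = 0"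
      by (auto simp: determining_def)
    then have zb: "z $ b \<noteq> 0" using determiningD[OF B] by blast
    let ?z = "(1 / z $ b) *\<^sub>R z"
    have val: "\<forall>e\<in>B. ?z $ e = of_bool (e = b)" using z(3) zb by auto
    then have "?z \<in> H1_int G"
      using z(1) by (intro integral_if_integral_on_determining[OF B] H1_real_scale) auto
    with val show ?thesis by blast
  qed
  then obtain \<zeta> where "\<forall>b\<in>B. \<zeta> b \<in> H1_int G \<and> (\<forall>e\<in>B. \<zeta> b $ e = of_bool (e = b))"
    by metis
  with B show ?thesis using that by (auto simp: cycle_basis_def)
qed

lemma cycle_basis_combination_nth:
  assumes "cycle_basis G B \<zeta>" "e \<in> B"
  shows "(\<Sum>b\<in>B. f b *\<^sub>R \<zeta> b) $ e = f e"
proof -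
  have "(\<Sum>b\<in>B. f b *\<^sub>R \<zeta> b) $ e = (\<Sum>b\<in>B. if e = b then f b else 0)"
    using assms by (auto simp: cycle_basis_def intro!: sum.cong)
  then show ?thesis using assms(2) by simp
qed

lemma cycle_basis_combination_in:
  "cycle_basis G B \<zeta> \<Longrightarrow> (\<Sum>b\<in>B. f b *\<^sub>R \<zeta> b) \<in> H1_real G"
  by (intro H1_real_sum H1_real_scale) (simp add: cycle_basis_def H1_int_def)

lemma cycle_basis_expansion:
  assumes B: "cycle_basis G B \<zeta>" and c: "c \<in> H1_real G"
  shows "c = (\<Sum>b\<in>B. c $ b *\<^sub>R \<zeta> b)"
proof -
  have "c - (\<Sum>b\<in>B. c $ b *\<^sub>R \<zeta> b) = 0"
    using B cycle_basis_combination_nth[OF B] c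
    by (intro determiningD[of G B] H1_real_diff cycle_basis_combination_in) (auto simp: cycle_basis_def)
  then show ?thesis by simp
qed

text \<open>
  Restriction of the coefficients to \<open>B\<close> is an isomorphism from the cycles onto the functions on
  \<open>B\<close>: it is injective as \<open>B\<close> is determining, and surjective because of the dual cycles.
\<close>

lemma card_cycle_basis:
  assumes B: "cycle_basis G B \<zeta>"
  shows "card B = betti1 G"
proof -
  let ?p = "\<lambda>x :: real ^ 'b. \<chi> e. if e \<in> B then x $ e else 0"
  have lin: "linear ?p" by (rule linearI) (auto simp: vec_eq_iff)
  have "inj_on ?p (span (H1_real G))"
  proof (rule inj_onI)
    fix x y assume "x \<in> span (H1_real G)" "y \<in> span (H1_real G)" and eq: "?p x = ?p y"
    then have "x \<in> H1_real G" "y \<in> H1_real G"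
      using subspace_H1_real[of G] by (simp_all add: span_eq_iff[THEN iffD2])
    moreover have "(x - y) $ e = 0" if "e \<in> B" for e
      using arg_cong[OF eq, of "\<lambda>v. v $ e"] that by simp
    ultimately have "x - y = 0"
      using B by (intro determiningD[of G B] H1_real_diff) (auto simp: cycle_basis_def)
    then show "x = y" by simp
  qed
  then have "dim (?p ` H1_real G) = betti1 G"
    unfolding betti1_def by (rule dim_image_eq[OF lin])
  moreover have "?p ` H1_real G = {x. \<forall>e. e \<notin> B \<longrightarrow> x $ e = 0}"
  proof (intro equalityI subsetI)
    fix x :: "real ^ 'b" assume x: "x \<in> {x. \<forall>e. e \<notin> B \<longrightarrow> x $ e = 0}"
    have "x = ?p (\<Sum>b\<in>B. x $ b *\<^sub>R \<zeta> b)"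
      unfolding vec_eq_iff
    proof
      fix e
      show "x $ e = ?p (\<Sum>b\<in>B. x $ b *\<^sub>R \<zeta> b) $ e"
        using x cycle_basis_combination_nth[OF B, of e "\<lambda>b. x $ b"] by auto
    qed
    then show "x \<in> ?p ` H1_real G" using cycle_basis_combination_in[OF B] by blast
  qed auto
  ultimately show ?thesis by (simp add: dim_supported_in)
qed

section \<open>The unit ball of the weighted l1 norm on cycles\<close>

definition weighted_l1 :: "('v::finite, 'e::finite) wgraph \<Rightarrow> real ^ 'e \<Rightarrow> real" where
  "weighted_l1 G c = (\<Sum>e\<in>UNIV. weight G e * \<bar>c $ e\<bar>)"

definition l1_ball :: "('v::finite, 'e::finite) wgraph \<Rightarrow> (real ^ 'e) set" where
  "l1_ball G = {u \<in> H1_real G. weighted_l1 G u \<le> 1}"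

lemma weighted_graph_weight_pos: "weighted_graph G \<Longrightarrow> 0 < weight G e"
  by (simp add: weighted_graph_def)

lemma weighted_l1_scale: "weighted_l1 G (r *\<^sub>R c) = \<bar>r\<bar> * weighted_l1 G c"
  by (simp add: weighted_l1_def sum_distrib_left abs_mult algebra_simps)

lemma weighted_l1_zero [simp]: "weighted_l1 G 0 = 0"
  by (simp add: weighted_l1_def)

lemma weighted_l1_nonneg: "weighted_graph G \<Longrightarrow> 0 \<le> weighted_l1 G c"
  by (auto simp: weighted_l1_def weighted_graph_weight_pos less_imp_le intro!: sum_nonneg)

lemma weight_le_weighted_l1:
  assumes "weighted_graph G"
  shows "weight G e * \<bar>c $ e\<bar> \<le> weighted_l1 G c"
  unfolding weighted_l1_def
  using assms by (intro member_le_sum) (auto simp: weighted_graph_weight_pos less_imp_le)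

lemma weighted_l1_eq_0_iff:
  assumes "weighted_graph G"
  shows "weighted_l1 G c = 0 \<longleftrightarrow> c = 0"
proof
  assume "weighted_l1 G c = 0"
  then have "c $ e = 0" for e
    using weight_le_weighted_l1[OF assms, of e c] weighted_graph_weight_pos[OF assms, of e]
    by (simp add: mult_le_0_iff)
  then show "c = 0" by (simp add: vec_eq_iff)
qed simp

lemma continuous_on_weighted_l1: "continuous_on A (weighted_l1 G)"
  unfolding weighted_l1_def by (intro continuous_intros)

text \<open>
  The inequality \<open>weighted_l1 G u \<le> 1\<close> is the conjunction of the linear inequalities that replace
  the absolute values by arbitrary signs, one for each set of edges.
\<close>

lemma polytope_l1_ball:
  assumes G: "weighted_graph G"
  shows "polytope (l1_ball G)"
proof -
  define halfspace where "halfspace S =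
    {u. (\<chi> e. (if e \<in> S then 1 else - 1) * weight G e) \<bullet> u \<le> 1}" for S
  have halfspace: "u \<in> halfspace S \<longleftrightarrow>
      (\<Sum>e\<in>UNIV. weight G e * (if e \<in> S then u $ e else - (u $ e))) \<le> 1" for u S
    by (auto simp: halfspace_def inner_vec_def intro!: sum.cong arg_cong2[where f = "(\<le>)"])
  have "l1_ball G = H1_real G \<inter> \<Inter>(range halfspace)"
  proof (intro equalityI subsetI IntI)
    fix u assume u: "u \<in> l1_ball G"
    show "u \<in> \<Inter>(range halfspace)"
    proof clarify
      fix S
      have "(\<Sum>e\<in>UNIV. weight G e * (if e \<in> S then u $ e else - (u $ e))) \<le> weighted_l1 G u"
        unfolding weighted_l1_def
        using weighted_graph_weight_pos[OF G] by (intro sum_mono mult_left_mono) (auto simp: less_imp_le)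
      then show "u \<in> halfspace S" using u by (simp add: halfspace l1_ball_def)
    qed
  next
    fix u assume u: "u \<in> H1_real G \<inter> \<Inter>(range halfspace)"
    have "weighted_l1 G u = (\<Sum>e\<in>UNIV. weight G e * (if e \<in> {e. u $ e \<ge> 0} then u $ e else - (u $ e)))"
      unfolding weighted_l1_def by (intro sum.cong) auto
    also have "\<dots> \<le> 1" using u halfspace by blast
    finally show "u \<in> l1_ball G" using u by (simp add: l1_ball_def)
  qed (auto simp: l1_ball_def)
  moreover have "polyhedron (H1_real G)"
    by (intro affine_imp_polyhedron subspace_imp_affine subspace_H1_real)
  moreover have "polyhedron (\<Inter>(range halfspace))"
    by (intro polyhedron_Inter) (auto simp: halfspace_def polyhedron_halfspace_le)
  ultimately have "polyhedron (l1_ball G)" by simp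
  moreover have "bounded (l1_ball G)"
  proof -
    have "norm u \<le> (\<Sum>e\<in>UNIV. 1 / weight G e)" if "u \<in> l1_ball G" for u
    proof -
      have "norm u \<le> (\<Sum>e\<in>UNIV. \<bar>u $ e\<bar>)" by (rule norm_le_l1_cart)
      also have "\<dots> \<le> (\<Sum>e\<in>UNIV. 1 / weight G e)"
      proof (rule sum_mono)
        fix e
        show "\<bar>u $ e\<bar> \<le> 1 / weight G e"
          using weight_le_weighted_l1[OF G, of e u] that weighted_graph_weight_pos[OF G, of e]
          by (auto simp: l1_ball_def field_simps)
      qed
      finally show ?thesis .
    qed
    then show ?thesis unfolding bounded_iff by blast
  qed
  ultimately show ?thesis by (simp add: polytope_eq_bounded_polyhedron)
qed

lemma normalized_in_l1_ball:
  assumes "weighted_graph G" "x \<in> H1_real G"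
  shows "(1 / weighted_l1 G x) *\<^sub>R x \<in> l1_ball G"
  using assms weighted_l1_nonneg[of G x]
  by (simp add: l1_ball_def H1_real_scale weighted_l1_scale weighted_l1_eq_0_iff)

lemma aff_dim_l1_ball:
  assumes G: "weighted_graph G"
  shows "aff_dim (l1_ball G) = int (betti1 G)"
proof -
  have "0 \<in> l1_ball G" by (simp add: l1_ball_def H1_real_zero)
  then have "aff_dim (l1_ball G) = int (dim (l1_ball G))"
    by (intro aff_dim_zero) (simp add: hull_inc)
  moreover have "span (l1_ball G) = H1_real G"
  proof (intro equalityI)
    show "span (l1_ball G) \<subseteq> H1_real G"
      by (rule span_minimal) (auto simp: l1_ball_def subspace_H1_real)
    show "H1_real G \<subseteq> span (l1_ball G)"
    proof
      fix x assume x: "x \<in> H1_real G"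
      have "x = weighted_l1 G x *\<^sub>R ((1 / weighted_l1 G x) *\<^sub>R x)"
        using G by (cases "x = 0") (auto simp: weighted_l1_eq_0_iff)
      moreover have "\<dots> \<in> span (l1_ball G)"
        by (intro span_scale[of "(1 / weighted_l1 G x) *\<^sub>R x"] span_base normalized_in_l1_ball[OF G x])
      ultimately show "x \<in> span (l1_ball G)" by simp
    qed
  qed
  ultimately show ?thesis unfolding betti1_def by (metis dim_span)
qed

subsection \<open>Extreme points\<close>

lemma extreme_point_rigid:
  assumes u: "u extreme_point_of S" and "u + x \<in> S" "u - x \<in> S"
  shows "(x :: 'a :: real_vector) = 0"
proof (rule ccontr)
  assume "x \<noteq> 0"
  then have "u \<in> open_segment (u + x) (u - x)"
    unfolding in_segment by (intro conjI exI[of _ "1/2"]) (auto simp: algebra_simps scaleR_2[symmetric])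
  then show False using assms by (auto simp: extreme_point_of_def)
qed

text \<open>
  No coefficient of \<open>u\<close> changes its sign under so small a perturbation, so the norm is affine there.
\<close>

lemma weighted_l1_perturb:
  assumes "\<And>e. \<bar>x $ e\<bar> \<le> \<bar>u $ e\<bar>"
  shows "weighted_l1 G (u + x) = weighted_l1 G u + (\<Sum>e\<in>UNIV. weight G e * (sgn (u $ e) * x $ e))"
proof -
  have "\<bar>u $ e + x $ e\<bar> = \<bar>u $ e\<bar> + sgn (u $ e) * x $ e" for e
    using assms[of e] by (auto simp: sgn_if abs_if split: if_splits)
  then show ?thesis
    by (simp add: weighted_l1_def sum.distrib[symmetric] distrib_left)
qed

lemma exists_small_multiple:
  fixes u c :: "real ^ 'n"
  assumes "\<And>e. u $ e = 0 \<Longrightarrow> c $ e = 0"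
  obtains \<epsilon> where "\<epsilon> > 0" "\<And>e. \<bar>\<epsilon> * c $ e\<bar> \<le> \<bar>u $ e\<bar>"
proof -
  \<comment> \<open>The \<open>1\<close> keeps the set nonempty when \<open>u = 0\<close>.\<close>
  define m where "m = Min (insert 1 ((\<lambda>e. \<bar>u $ e\<bar>) ` {e. u $ e \<noteq> 0}))"
  have m: "m > 0" "\<And>e. u $ e \<noteq> 0 \<Longrightarrow> m \<le> \<bar>u $ e\<bar>"
    unfolding m_def by (auto intro!: Min_le)
  have "\<bar>m / (1 + (\<Sum>e\<in>UNIV. \<bar>c $ e\<bar>)) * c $ e\<bar> \<le> \<bar>u $ e\<bar>" for e
  proof (cases "u $ e = 0")
    case False
    have le: "\<bar>c $ e\<bar> \<le> (\<Sum>e\<in>UNIV. \<bar>c $ e\<bar>)" by (intro member_le_sum) auto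
    have "0 \<le> (\<Sum>e\<in>UNIV. \<bar>c $ e\<bar>)" by (intro sum_nonneg) auto
    have "m * \<bar>c $ e\<bar> / (1 + (\<Sum>e\<in>UNIV. \<bar>c $ e\<bar>)) \<le> m" (is "?l / ?d \<le> m")
    proof -
      have "?l \<le> m * ?d" using m(1) le by (intro mult_left_mono) auto
      then show ?thesis using \<open>0 \<le> (\<Sum>e\<in>UNIV. \<bar>c $ e\<bar>)\<close> by (subst pos_divide_le_eq) (simp_all add: add_pos_nonneg)
    qed
    then show ?thesis
      using m False \<open>0 \<le> (\<Sum>e\<in>UNIV. \<bar>c $ e\<bar>)\<close> by (force simp: abs_mult)
  qed (use assms in simp)
  moreover have "m / (1 + (\<Sum>e\<in>UNIV. \<bar>c $ e\<bar>)) > 0"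
    using m(1) by (intro divide_pos_pos add_pos_nonneg sum_nonneg) auto
  ultimately show ?thesis using that by blast
qed

lemma extreme_point_nonzero:
  assumes G: "weighted_graph G" and b: "betti1 G \<ge> 1" and u: "u extreme_point_of l1_ball G"
  shows "u \<noteq> 0"
proof
  assume u0: "u = 0"
  have "\<not> H1_real G \<subseteq> {0}" using b unfolding betti1_def by (metis dim_eq_0 not_one_le_zero)
  then obtain x where x: "x \<in> H1_real G" "x \<noteq> 0" by blast
  let ?x = "(1 / weighted_l1 G x) *\<^sub>R x"
  have "?x \<in> l1_ball G" by (rule normalized_in_l1_ball[OF G x(1)])
  moreover have "- ?x \<in> l1_ball G"
    using normalized_in_l1_ball[OF G H1_real_scale[OF x(1), of "-1"]] weighted_l1_scale[of G "-1" x] by simp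
  ultimately have "?x = 0" using extreme_point_rigid[OF u, of ?x] u0 by simp
  then show False using x G by (simp add: weighted_l1_eq_0_iff)
qed

lemma extreme_point_norm:
  assumes G: "weighted_graph G" and b: "betti1 G \<ge> 1" and u: "u extreme_point_of l1_ball G"
  shows "weighted_l1 G u = 1"
proof (rule ccontr)
  let ?L = "weighted_l1 G u"
  have uH: "u \<in> H1_real G" and "?L \<le> 1" using u by (auto simp: extreme_point_of_def l1_ball_def)
  assume "?L \<noteq> 1"
  with \<open>?L \<le> 1\<close> have L: "0 \<le> ?L" "?L < 1" using weighted_l1_nonneg[OF G] by auto
  have near: "u + s *\<^sub>R u \<in> l1_ball G" if "\<bar>s\<bar> \<le> 1 - ?L" for s
  proof -
    have "\<bar>1 + s\<bar> * ?L \<le> (2 - ?L) * ?L" using that L by (intro mult_right_mono) auto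
    also have "\<dots> = 1 - (1 - ?L)\<^sup>2" by (simp add: power2_eq_square algebra_simps)
    also have "\<dots> \<le> 1" by simp
    finally have "(1 + s) *\<^sub>R u \<in> l1_ball G"
      using uH by (simp add: l1_ball_def H1_real_scale weighted_l1_scale)
    then show ?thesis by (simp only: scaleR_add_left scaleR_one)
  qed
  have "(1 - ?L) *\<^sub>R u = 0"
  proof (rule extreme_point_rigid[OF u])
    show "u + (1 - ?L) *\<^sub>R u \<in> l1_ball G" using L by (intro near) auto
    show "u - (1 - ?L) *\<^sub>R u \<in> l1_ball G" using near[of "- (1 - ?L)"] L by (simp add: scaleR_left_diff_distrib)
  qed
  then show False using L extreme_point_nonzero[OF assms] by simp
qed

text \<open>
  Near \<open>u\<close> the norm is affine in the directions supported in the support of \<open>u\<close>. Subtracting from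
  \<open>c\<close> the right multiple of \<open>u\<close> leaves a direction \<open>d\<close> of slope \<open>0\<close>, and then \<open>u\<close> is the midpoint
  of the two points \<open>u \<plusminus> \<epsilon> d\<close> of the ball, which forces \<open>d = 0\<close>.
\<close>

lemma cycle_in_extreme_support:
  assumes G: "weighted_graph G" and b: "betti1 G \<ge> 1" and u: "u extreme_point_of l1_ball G"
    and c: "c \<in> H1_real G" and supp: "\<And>e. u $ e = 0 \<Longrightarrow> c $ e = 0"
  obtains k where "c = k *\<^sub>R u"
proof -
  define slope where "slope x = (\<Sum>e\<in>UNIV. weight G e * (sgn (u $ e) * x $ e))" for x :: "real ^ 'b"
  have uH: "u \<in> H1_real G" using u by (auto simp: extreme_point_of_def l1_ball_def)
  have slope_u: "slope u = 1"
    using extreme_point_norm[OF G b u]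
    by (simp add: slope_def weighted_l1_def abs_sgn[of "u $ _"] mult.commute[of "sgn _"])
  define d where "d = c - slope c *\<^sub>R u"
  have "slope d = slope c - slope c * slope u"
    by (simp add: slope_def d_def right_diff_distrib sum_subtractf sum_distrib_left mult.left_commute)
  then have slope_d: "slope d = 0" by (simp add: slope_u)
  obtain \<epsilon> where \<epsilon>: "\<epsilon> > 0" "\<And>e. \<bar>\<epsilon> * d $ e\<bar> \<le> \<bar>u $ e\<bar>"
    using exists_small_multiple[of u d] supp by (auto simp: d_def)
  have "u + s *\<^sub>R d \<in> l1_ball G" if "\<bar>s\<bar> = \<epsilon>" for s
  proof -
    have "slope (s *\<^sub>R d) = s * slope d"
      by (simp add: slope_def sum_distrib_left mult.left_commute)
    moreover have "\<bar>(s *\<^sub>R d) $ e\<bar> \<le> \<bar>u $ e\<bar>" for e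
      using \<epsilon>(2)[of e] that by (auto simp: abs_mult)
    ultimately have "weighted_l1 G (u + s *\<^sub>R d) = 1"
      using weighted_l1_perturb[of "s *\<^sub>R d" u G] extreme_point_norm[OF G b u] slope_d
      by (simp add: slope_def)
    then show ?thesis
      using uH c by (simp add: l1_ball_def d_def H1_real_add H1_real_diff H1_real_scale)
  qed
  from this[of \<epsilon>] this[of "- \<epsilon>"] \<epsilon>(1) have "\<epsilon> *\<^sub>R d = 0"
    by (intro extreme_point_rigid[OF u]) auto
  then have "c = slope c *\<^sub>R u" using \<epsilon>(1) by (simp add: d_def)
  then show ?thesis by (rule that)
qed

text \<open>
  After scaling so that the coefficient at \<open>f\<close> is \<open>1\<close>, all coefficients are integers: a cycle on the
  nonintegral edges would be a multiple of \<open>u\<close> vanishing at \<open>f\<close>. Thus the quotient of any two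
  nonzero coefficients is an integer, and so is its inverse.
\<close>

lemma extreme_point_uniform:
  assumes G: "weighted_graph G" and b: "betti1 G \<ge> 1" and u: "u extreme_point_of l1_ball G"
    and ef: "u $ e \<noteq> 0" "u $ f \<noteq> 0"
  shows "\<bar>u $ e\<bar> = \<bar>u $ f\<bar>"
proof -
  have uH: "u \<in> H1_real G" using u by (auto simp: extreme_point_of_def l1_ball_def)
  have int: "u $ e / u $ f \<in> \<int>" if "u $ f \<noteq> 0" for e f
  proof (rule ccontr)
    assume "u $ e / u $ f \<notin> \<int>"
    then have "((1 / u $ f) *\<^sub>R u) $ e \<notin> \<int>" by simp
    then obtain z where z: "z \<in> H1_real G" "z \<noteq> 0" "\<And>e. ((1 / u $ f) *\<^sub>R u) $ e \<in> \<int> \<Longrightarrow> z $ e = 0"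
      using exists_cycle_supported_in_nonintegral[OF H1_real_scale[OF uH]] by metis
    obtain k where k: "z = k *\<^sub>R u"
      using z by (auto intro: cycle_in_extreme_support[OF G b u, of z])
    have "z $ f = 0" using that by (intro z(3)) simp
    then show False using k that z(2) by simp
  qed
  have "\<bar>u $ f\<bar> \<le> \<bar>u $ e\<bar>" if ef: "u $ e \<noteq> 0" "u $ f \<noteq> 0" for e f
    using Ints_nonzero_abs_ge1[OF int[of f e]] ef by (simp add: field_simps abs_divide)
  then show ?thesis using ef by (meson order_antisym)
qed

lemma extreme_point_eq_or_opposite:
  assumes G: "weighted_graph G" and b: "betti1 G \<ge> 1"
    and u: "u extreme_point_of l1_ball G" and v: "v extreme_point_of l1_ball G"
    and B: "determining G B" and same: "\<And>e. e \<in> B \<Longrightarrow> u $ e = 0 \<longleftrightarrow> v $ e = 0"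
  shows "v = u \<or> v = - u"
proof -
  have signs: "\<exists>\<mu>>0. \<forall>e. x $ e \<noteq> 0 \<longrightarrow> (\<mu> *\<^sub>R x) $ e \<in> {1, -1}"
    if x: "x extreme_point_of l1_ball G" for x
  proof -
    obtain f where f: "x $ f \<noteq> 0" using extreme_point_nonzero[OF G b x] by (auto simp: vec_eq_iff)
    have "((1 / \<bar>x $ f\<bar>) *\<^sub>R x) $ e \<in> {1, -1}" if "x $ e \<noteq> 0" for e
    proof -
      have "x $ e = \<bar>x $ f\<bar> \<or> x $ e = - \<bar>x $ f\<bar>"
        using extreme_point_uniform[OF G b x that f] by linarith
      then show ?thesis using f by (elim disjE) simp_all
    qed
    moreover have "1 / \<bar>x $ f\<bar> > 0" using f by simp
    ultimately show ?thesis by blast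
  qed
  obtain \<nu> \<mu> where \<nu>: "\<nu> > 0" "\<And>e. u $ e \<noteq> 0 \<Longrightarrow> (\<nu> *\<^sub>R u) $ e \<in> {1, -1}"
    and \<mu>: "\<mu> > 0" "\<And>e. v $ e \<noteq> 0 \<Longrightarrow> (\<mu> *\<^sub>R v) $ e \<in> {1, -1}"
    using signs[OF u] signs[OF v] by metis
  have H: "u \<in> H1_real G" "v \<in> H1_real G"
    using u v by (auto simp: extreme_point_of_def l1_ball_def)
  define z where "z = (1/2) *\<^sub>R (\<nu> *\<^sub>R u - \<mu> *\<^sub>R v)"
  have "z \<in> H1_int G"
  proof (rule integral_if_integral_on_determining[OF B])
    show "z \<in> H1_real G" unfolding z_def using H by (intro H1_real_scale H1_real_diff)
    fix e assume e: "e \<in> B"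
    show "z $ e \<in> \<int>"
      using \<nu>(2)[of e] \<mu>(2)[of e] same[OF e] by (cases "u $ e = 0") (auto simp: z_def)
  qed
  then have z: "z $ e \<in> \<int>" for e by (simp add: H1_int_def)
  have "v $ e = 0" if "u $ e = 0" for e
  proof (rule ccontr)
    assume "v $ e \<noteq> 0"
    then have "\<bar>(\<mu> *\<^sub>R v) $ e\<bar> = 1" using \<mu>(2)[of e] by fastforce
    then have "\<bar>z $ e\<bar> = 1/2" using that by (simp add: z_def)
    then show False using Ints_nonzero_abs_ge1[OF z[of e]] by force
  qed
  then obtain k where k: "v = k *\<^sub>R u" using cycle_in_extreme_support[OF G b u H(2)] by metis
  then have "\<bar>k\<bar> = 1"
    using extreme_point_norm[OF G b u] extreme_point_norm[OF G b v] by (simp add: weighted_l1_scale)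
  then show ?thesis using k by (auto simp: abs_if split: if_splits)
qed

lemma card_extreme_points_l1_ball:
  assumes G: "weighted_graph G" and b: "betti1 G \<ge> 1"
  shows "card {v. v extreme_point_of l1_ball G} \<le> 2 * (2 ^ betti1 G - 1)"
proof -
  obtain B \<zeta> where B: "cycle_basis G B \<zeta>" by (rule exists_cycle_basis)
  then have det: "determining G B" by (simp add: cycle_basis_def)
  define X where "X = {v. v extreme_point_of l1_ball G}"
  define trace where "trace u = {e \<in> B. u $ e \<noteq> 0}" for u :: "real ^ 'b"
  have fin: "finite X"
    unfolding X_def by (intro finite_polyhedron_extreme_points polytope_imp_polyhedron polytope_l1_ball G)
  have trace: "trace ` X \<subseteq> Pow B - {{}}"
  proof -
    have "trace u \<noteq> {}" if "u \<in> X" for u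
    proof
      assume "trace u = {}"
      then have "u = 0" using that
        by (intro determiningD[OF det]) (auto simp: trace_def X_def extreme_point_of_def l1_ball_def)
      then show False using extreme_point_nonzero[OF G b] that by (auto simp: X_def)
    qed
    then show ?thesis by (auto simp: trace_def)
  qed
  have two: "card {u \<in> X. trace u = T} \<le> 2" for T
  proof (cases "\<exists>u\<in>X. trace u = T")
    case True
    then obtain u where u: "u \<in> X" "trace u = T" by blast
    have "{v \<in> X. trace v = T} \<subseteq> {u, - u}"
      using u extreme_point_eq_or_opposite[OF G b _ _ det, of u] by (fastforce simp: X_def trace_def)
    then have "card {v \<in> X. trace v = T} \<le> card {u, - u}" by (intro card_mono) auto
    also have "\<dots> \<le> 2" by (simp add: card_insert_if)
    finally show ?thesis .
  next
    case False
    then have "{u \<in> X. trace u = T} = {}" by blast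
    then show ?thesis by (simp only: card.empty)
  qed
  have "card X = (\<Sum>T\<in>Pow B - {{}}. card {u \<in> X. trace u = T})"
    using sum.group[OF fin _ trace, of "\<lambda>_. 1 :: nat"] by simp
  also have "\<dots> \<le> (\<Sum>T\<in>Pow B - {{}}. 2)" by (intro sum_mono two)
  also have "\<dots> = 2 * (2 ^ betti1 G - 1)"
    using card_cycle_basis[OF B] by (simp add: card_Diff_singleton card_Pow)
  finally show ?thesis by (simp add: X_def)
qed

section \<open>The length metric\<close>

lemma joined_nonneg: "joined G x l y \<Longrightarrow> 0 \<le> l"
  by (induction rule: joined.induct) auto

lemma joined_segment:
  "s \<in> {0..weight G e} \<Longrightarrow> t \<in> {0..weight G e} \<Longrightarrow>
    joined G (edge_point G e s) \<bar>s - t\<bar> (edge_point G e t)"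
  using joined.step[OF _ _ joined.refl, of s G e t] by simp

lemma joined_trans: "joined G x l y \<Longrightarrow> joined G y m z \<Longrightarrow> joined G x (l + m) z"
proof (induction rule: joined.induct)
  case (step s e t l y)
  then show ?case using joined.step[of s G e t "l + m" z] by (simp add: add.assoc)
qed simp

lemma joined_sym: "joined G x l y \<Longrightarrow> joined G y l x"
proof (induction rule: joined.induct)
  case (step s e t l y)
  then show ?case using joined_trans[OF _ joined_segment[of t G e s]]
    by (simp add: add.commute abs_minus_commute)
qed (rule joined.refl)

lemma edge_point_in_points: "t \<in> {0..weight G e} \<Longrightarrow> edge_point G e t \<in> points G"
  by (auto simp: edge_point_def points_def)

lemma edge_point_ends:
  assumes "weighted_graph G"
  shows "edge_point G e 0 = Vertex (src G e)" "edge_point G e (weight G e) = Vertex (tgt G e)"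
  using weighted_graph_weight_pos[OF assms, of e] by (auto simp: edge_point_def)

lemma points_cases:
  assumes "x \<in> points G"
  obtains v where "x = Vertex v"
    | e t where "x = Inner e t" "x = edge_point G e t" "0 < t" "t < weight G e"
  using assms by (auto simp: points_def edge_point_def)

lemma exists_joined:
  fixes G :: "('v::finite, 'e::finite) wgraph"
  assumes G: "weighted_graph G" and "x \<in> points G" "y \<in> points G"
  shows "\<exists>l. joined G x l y"
proof -
  have edge: "joined G (Vertex (src G e)) (weight G e) (Vertex (tgt G e))" for e
    using joined_segment[of 0 G e "weight G e"] weighted_graph_weight_pos[OF G, of e]
    by (simp add: edge_point_ends[OF G])
  have vertices: "\<exists>l. joined G (Vertex u) l (Vertex v)" for u v
  proof -
    have "(u, v) \<in> (adjacency G)\<^sup>*" using G by (simp add: weighted_graph_def)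
    then show ?thesis
    proof (induction rule: rtrancl_induct)
      case base
      show ?case using joined.refl by blast
    next
      case (step v w)
      from step(2) obtain l where "joined G (Vertex v) l (Vertex w)"
        using edge joined_sym[OF edge] by (force simp: adjacency_def)
      with step(3) show ?case using joined_trans by blast
    qed
  qed
  have to_vertex: "\<exists>v l. joined G z l (Vertex v)" if "z \<in> points G" for z
    using that
  proof (cases rule: points_cases)
    case (1 v)
    then show ?thesis using joined.refl by blast
  next
    case (2 e t)
    then have "joined G z \<bar>t - 0\<bar> (Vertex (src G e))"
      using joined_segment[of t G e 0] by (simp add: edge_point_ends[OF G])
    then show ?thesis by blast
  qed
  obtain u l v m where "joined G x l (Vertex u)" "joined G y m (Vertex v)"
    using to_vertex assms(2,3) by metis
  moreover obtain k where "joined G (Vertex u) k (Vertex v)" using vertices by blast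
  ultimately show ?thesis using joined_trans joined_sym by blast
qed

lemma length_metric_le:
  assumes "x \<in> points G" "y \<in> points G" "joined G x l y"
  shows "length_metric G x y \<le> l"
  unfolding length_metric_def
  using assms by (auto intro!: cInf_lower bdd_belowI[of _ 0] dest: joined_nonneg)

lemma length_metric_ge:
  fixes G :: "('v::finite, 'e::finite) wgraph"
  assumes "weighted_graph G" "x \<in> points G" "y \<in> points G"
    and "\<And>l. joined G x l y \<Longrightarrow> k \<le> l"
  shows "k \<le> length_metric G x y"
  unfolding length_metric_def
  using assms exists_joined[OF assms(1-3)] by (auto intro!: cInf_greatest)

lemma joined_Lipschitz:
  assumes "joined G x l y"
    and "\<And>e s t. s \<in> {0..weight G e} \<Longrightarrow> t \<in> {0..weight G e} \<Longrightarrow>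
      dist (f (edge_point G e s)) (f (edge_point G e t)) \<le> K * \<bar>s - t\<bar>"
  shows "dist (f x) (f y) \<le> K * l"
  using assms(1)
proof (induction rule: joined.induct)
  case (step s e t l y)
  then show ?case
    using assms(2)[of s e t] dist_triangle[of "f (edge_point G e s)" "f y" "f (edge_point G e t)"]
    by (simp add: distrib_left)
qed simp

lemma length_metric_Lipschitz:
  fixes G :: "('v::finite, 'e::finite) wgraph"
  assumes "weighted_graph G" "x \<in> points G" "y \<in> points G" "K > 0"
    and "\<And>e s t. s \<in> {0..weight G e} \<Longrightarrow> t \<in> {0..weight G e} \<Longrightarrow>
      dist (f (edge_point G e s)) (f (edge_point G e t)) \<le> K * \<bar>s - t\<bar>"
  shows "dist (f x) (f y) \<le> K * length_metric G x y"
proof -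
  have "dist (f x) (f y) / K \<le> length_metric G x y"
  proof (rule length_metric_ge[OF assms(1-3)])
    fix l assume "joined G x l y"
    then have "dist (f x) (f y) \<le> K * l" using assms(5) by (rule joined_Lipschitz)
    then show "dist (f x) (f y) / K \<le> l" using \<open>K > 0\<close> by (simp add: field_simps)
  qed
  then show ?thesis using \<open>K > 0\<close> by (simp add: field_simps)
qed

subsection \<open>Collapsing onto one edge\<close>

lemma collapse_edge_point:
  assumes "weighted_graph G" "t \<in> {0..weight G e}"
  shows "collapse G f (edge_point G e t) = (if f = e then cis (2 * pi * t / weight G e) else 1)"
  using assms weighted_graph_weight_pos[of G e] by (auto simp: edge_point_def collapse_def)

lemma cis_eq_iff: "cis a = cis b \<longleftrightarrow> (\<exists>n::int. a = b + 2 * pi * n)"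
  using sin_cos_eq_iff[of a b] by (auto simp: complex_eq_iff)

lemma dist_cis_le: "dist (cis a) (cis b) \<le> \<bar>a - b\<bar>"
proof -
  have "cis a - cis b = cis b * (cis (a - b) - 1)"
    by (simp add: algebra_simps cis_mult)
  then have "dist (cis a) (cis b) = norm (cis (a - b) - 1)"
    by (simp add: dist_norm norm_mult)
  also have "\<dots> = 2 * \<bar>sin ((a - b) / 2)\<bar>"
    using dist_exp_i_1[of "a - b"] by (simp add: cis_conv_exp)
  also have "\<dots> \<le> \<bar>a - b\<bar>" using abs_sin_x_le_abs_x[of "(a - b) / 2"] by simp
  finally show ?thesis .
qed

lemma collapse_Lipschitz:
  fixes G :: "('v::finite, 'e::finite) wgraph"
  assumes G: "weighted_graph G" and "x \<in> points G" "y \<in> points G"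
  shows "dist (collapse G f x) (collapse G f y) \<le> (2 * pi / weight G f) * length_metric G x y"
proof (rule length_metric_Lipschitz[OF assms])
  show "2 * pi / weight G f > 0" using weighted_graph_weight_pos[OF G] by simp
  fix e s t assume st: "s \<in> {0..weight G e}" "t \<in> {0..weight G e}"
  show "dist (collapse G f (edge_point G e s)) (collapse G f (edge_point G e t))
      \<le> (2 * pi / weight G f) * \<bar>s - t\<bar>"
  proof (cases "f = e")
    case True
    have "\<bar>2 * pi * s / weight G e - 2 * pi * t / weight G e\<bar> = 2 * pi / weight G e * \<bar>s - t\<bar>"
      using weighted_graph_weight_pos[OF G, of e]
      by (simp add: diff_divide_distrib[symmetric] right_diff_distrib[symmetric] abs_mult abs_divide)
    then show ?thesis
      using dist_cis_le[of "2 * pi * s / weight G e" "2 * pi * t / weight G e"] True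
      by (simp add: collapse_edge_point[OF G st(1)] collapse_edge_point[OF G st(2)])
  next
    case False
    then show ?thesis using weighted_graph_weight_pos[OF G, of f]
      by (simp add: collapse_edge_point[OF G st(1)] collapse_edge_point[OF G st(2)])
  qed
qed

text \<open>
  Moving along a chain of segments changes the position on the circle of the edge \<open>e\<close> by the angle
  \<open>2 * pi * d e / weight G e\<close>, where \<open>d e\<close> is the signed distance travelled on \<open>e\<close>. A segment
  moves on a single edge, so the total distance bounds the sum over all edges.
\<close>

lemma joined_lift:
  fixes G :: "('v::finite, 'e::finite) wgraph"
  assumes G: "weighted_graph G" and "joined G x l y"
  shows "\<exists>d. (\<forall>e. collapse G e y = collapse G e x * cis (2 * pi * d e / weight G e)) \<and>
    (\<Sum>e\<in>UNIV. \<bar>d e\<bar>) \<le> l"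
  using assms(2)
proof (induction rule: joined.induct)
  case (refl x)
  show ?case by (intro exI[of _ "\<lambda>_. 0"]) simp
next
  case (step s e t l y)
  then obtain d where d: "\<And>f. collapse G f y =
      collapse G f (edge_point G e t) * cis (2 * pi * d f / weight G f)" "(\<Sum>e\<in>UNIV. \<bar>d e\<bar>) \<le> l"
    by blast
  let ?d = "\<lambda>f. d f + (if f = e then t - s else 0)"
  have "collapse G f y = collapse G f (edge_point G e s) * cis (2 * pi * ?d f / weight G f)" for f
    unfolding d(1)[of f]
    using step.hyps
    by (auto simp: collapse_edge_point[OF G] cis_mult add_divide_distrib[symmetric] algebra_simps)
  moreover have "(\<Sum>f\<in>UNIV. \<bar>?d f\<bar>) \<le> \<bar>s - t\<bar> + l"
  proof -
    have "(\<Sum>f\<in>UNIV. \<bar>?d f\<bar>) \<le> (\<Sum>f\<in>UNIV. \<bar>d f\<bar> + (if f = e then \<bar>s - t\<bar> else 0))"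
      by (intro sum_mono) auto
    also have "\<dots> = (\<Sum>f\<in>UNIV. \<bar>d f\<bar>) + \<bar>s - t\<bar>" by (simp add: sum.distrib)
    finally show ?thesis using d(2) by simp
  qed
  ultimately show ?case by (intro exI[of _ ?d] conjI allI)
qed

text \<open>
  The angles travelled and the differences \<open>\<beta> e - \<alpha> e\<close> agree up to multiples of \<open>2 * pi\<close>, and among
  the representatives of an angle one of absolute value at most \<open>pi\<close> is the shortest.
\<close>

lemma length_metric_ge_lift:
  fixes G :: "('v::finite, 'e::finite) wgraph"
  assumes G: "weighted_graph G" and "x \<in> points G" "y \<in> points G"
    and \<alpha>: "\<And>e. collapse G e x = cis (\<alpha> e)" and \<beta>: "\<And>e. collapse G e y = cis (\<beta> e)"
    and small: "\<And>e. \<bar>\<beta> e - \<alpha> e\<bar> \<le> pi"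
  shows "(\<Sum>e\<in>UNIV. weight G e / (2 * pi) * \<bar>\<beta> e - \<alpha> e\<bar>) \<le> length_metric G x y"
proof (rule length_metric_ge[OF assms(1-3)])
  fix l assume "joined G x l y"
  then obtain d where d: "\<And>e. collapse G e y = collapse G e x * cis (2 * pi * d e / weight G e)"
      "(\<Sum>e\<in>UNIV. \<bar>d e\<bar>) \<le> l"
    using joined_lift[OF G] by blast
  have "weight G e / (2 * pi) * \<bar>\<beta> e - \<alpha> e\<bar> \<le> \<bar>d e\<bar>" for e
  proof -
    let ?D = "2 * pi * d e / weight G e"
    have "cis (\<beta> e) = cis (\<alpha> e + ?D)" using d(1)[of e] by (simp add: \<alpha> \<beta> cis_mult)
    then obtain n :: int where n: "\<beta> e = \<alpha> e + ?D + 2 * pi * n" unfolding cis_eq_iff by blast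
    have "\<bar>\<beta> e - \<alpha> e\<bar> \<le> \<bar>?D\<bar>"
    proof (cases "n = 0")
      case False
      then have "1 \<le> \<bar>real_of_int n\<bar>" by linarith
      then have "2 * pi * 1 \<le> 2 * pi * \<bar>real_of_int n\<bar>" by (intro mult_left_mono) auto
      also have "\<dots> = \<bar>2 * pi * real_of_int n\<bar>" by (simp add: abs_mult)
      finally show ?thesis using n small[of e] by linarith
    qed (use n in simp)
    also have "\<bar>?D\<bar> = 2 * pi / weight G e * \<bar>d e\<bar>"
      using weighted_graph_weight_pos[OF G, of e] by (simp add: abs_mult)
    finally show ?thesis using weighted_graph_weight_pos[OF G, of e] by (simp add: field_simps)
  qed
  then have "(\<Sum>e\<in>UNIV. weight G e / (2 * pi) * \<bar>\<beta> e - \<alpha> e\<bar>) \<le> (\<Sum>e\<in>UNIV. \<bar>d e\<bar>)"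
    by (intro sum_mono)
  with d(2) show "(\<Sum>e\<in>UNIV. weight G e / (2 * pi) * \<bar>\<beta> e - \<alpha> e\<bar>) \<le> l" by simp
qed

subsection \<open>The metric space axioms\<close>

text \<open>
  The collapse maps identify all vertices. To separate \<open>u\<close> from the other vertices, extend
  linearly over the edges the function that is the least weight at \<open>u\<close> and \<open>0\<close> at the others.
\<close>

lemma length_metric_Vertex_pos:
  fixes G :: "('v::finite, 'e::finite) wgraph"
  assumes G: "weighted_graph G" and "u \<noteq> v"
  shows "length_metric G (Vertex u) (Vertex v) \<noteq> 0"
proof -
  define m where "m = Min (range (weight G))"
  have m: "m > 0" "\<And>e. m \<le> weight G e"
    using weighted_graph_weight_pos[OF G] by (auto simp: m_def)
  define a where "a w = (if w = u then m else 0)" for w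
  define h where "h p = (case p of Vertex w \<Rightarrow> a w
    | Inner e t \<Rightarrow> a (src G e) + (a (tgt G e) - a (src G e)) / weight G e * t)" for p
  have h: "h (edge_point G e t) = a (src G e) + (a (tgt G e) - a (src G e)) / weight G e * t" for e t
    using weighted_graph_weight_pos[OF G, of e] by (auto simp: h_def edge_point_def)
  have "dist (h (Vertex u)) (h (Vertex v)) \<le> 1 * length_metric G (Vertex u) (Vertex v)"
  proof (rule length_metric_Lipschitz[OF G])
    fix e s t
    let ?k = "(a (tgt G e) - a (src G e)) / weight G e"
    have "\<bar>?k\<bar> \<le> 1"
      using m(1) m(2)[of e] by (simp add: a_def)
    have "dist (h (edge_point G e s)) (h (edge_point G e t)) = \<bar>?k * (s - t)\<bar>"
      by (simp add: h dist_real_def right_diff_distrib)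
    also have "\<dots> = \<bar>?k\<bar> * \<bar>s - t\<bar>" by (rule abs_mult)
    also have "\<dots> \<le> 1 * \<bar>s - t\<bar>" using \<open>\<bar>?k\<bar> \<le> 1\<close> by (intro mult_right_mono) auto
    finally show "dist (h (edge_point G e s)) (h (edge_point G e t)) \<le> 1 * \<bar>s - t\<bar>" .
  qed (auto simp: points_def)
  then show ?thesis using m(1) \<open>u \<noteq> v\<close> by (simp add: h_def a_def dist_real_def)
qed

text \<open>
  An inner point of an edge is separated from all other points by the collapse onto that edge.
\<close>

lemma length_metric_eq_0_imp_eq:
  fixes G :: "('v::finite, 'e::finite) wgraph"
  assumes G: "weighted_graph G" and x: "x \<in> points G" and y: "y \<in> points G"
    and d0: "length_metric G x y = 0"
  shows "x = y"
proof -
  have same: "collapse G e x = collapse G e y" for e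
    using collapse_Lipschitz[OF G x y, of e] d0 by simp
  have cis_inj: "s = t" if "cis (2 * pi * s / w) = cis (2 * pi * t / w)"
    "0 \<le> s" "s < w" "0 \<le> t" "t < w" for s t w :: real
  proof -
    note cis_eq = that(1)
    obtain n :: int where "2 * pi * s / w = 2 * pi * t / w + 2 * pi * n"
      using cis_eq unfolding cis_eq_iff by blast
    then have "2 * pi * (s - t) = 2 * pi * (n * w)" using that(2,3) by (simp add: field_simps)
    then have n: "s - t = n * w" by simp
    moreover have "\<bar>s - t\<bar> < w" using that by auto
    ultimately have "\<bar>real_of_int n\<bar> * w < 1 * w" using that(2,3) by (simp add: abs_mult)
    then have "\<bar>real_of_int n\<bar> < 1" using that(2,3) by (simp add: mult_less_cancel_right)
    then have "n = 0" by linarith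
    then show ?thesis using n by simp
  qed
  have determined: "Inner e t = q"
    if p: "Inner e t \<in> points G" "q \<in> points G" "collapse G e (Inner e t) = collapse G e q" for e t q
  proof -
    have t: "0 < t" "t < weight G e" using p(1) by (auto simp: points_def)
    have c: "collapse G e q = cis (2 * pi * t / weight G e)" using p(3) by (simp add: collapse_def)
    have ne: "collapse G e q \<noteq> 1" using cis_inj[of t "weight G e" 0] t c by auto
    then obtain s where q: "q = Inner e s"
      by (auto simp: collapse_def split: point.splits if_splits)
    then have "0 < s" "s < weight G e" using p(2) by (auto simp: points_def)
    then show ?thesis using cis_inj[of t "weight G e" s] t c q by (simp add: collapse_def)
  qed
  show ?thesis
  proof (cases x)
    case (Inner e t)
    then show ?thesis using determined x y same by blast
  next
    case (Vertex u)
    then show ?thesis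
    proof (cases y)
      case (Inner e t)
      then show ?thesis using determined[of e t x] x y same[of e] by simp
    next
      case (Vertex v)
      then show ?thesis using length_metric_Vertex_pos[OF G, of u v] \<open>x = Vertex u\<close> d0 by auto
    qed
  qed
qed

lemma length_metric_triangle:
  fixes G :: "('v::finite, 'e::finite) wgraph"
  assumes G: "weighted_graph G" and x: "x \<in> points G" and y: "y \<in> points G" and z: "z \<in> points G"
  shows "length_metric G x z \<le> length_metric G x y + length_metric G y z"
proof -
  have "length_metric G x z - length_metric G x y \<le> length_metric G y z"
  proof (rule length_metric_ge[OF G y z])
    fix m assume m: "joined G y m z"
    have "length_metric G x z - m \<le> length_metric G x y"
      using length_metric_le[OF x z joined_trans[OF _ m]] by (intro length_metric_ge[OF G x y]) force
    then show "length_metric G x z - length_metric G x y \<le> m" by simp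
  qed
  then show ?thesis by simp
qed

lemma Metric_space_length_metric:
  fixes G :: "('v::finite, 'e::finite) wgraph"
  assumes G: "weighted_graph G"
  shows "Metric_space (points G) (length_metric G)"
proof
  show "0 \<le> length_metric G x y" for x y
  proof (cases "x \<in> points G \<and> y \<in> points G")
    case True
    then show ?thesis by (intro length_metric_ge[OF G]) (auto dest: joined_nonneg)
  qed (auto simp: length_metric_def)
  then have nonneg: "\<And>x y. 0 \<le> length_metric G x y" .
  show "length_metric G x y = length_metric G y x" for x y
  proof -
    have "{l. joined G x l y} = {l. joined G y l x}" using joined_sym by blast
    then show ?thesis by (simp add: length_metric_def)
  qed
  show "length_metric G x y = 0 \<longleftrightarrow> x = y" if "x \<in> points G" "y \<in> points G" for x y
    using length_metric_eq_0_imp_eq[OF G that] length_metric_le[OF that] joined.refl[of G x]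
      nonneg[of x y] by force
qed (rule length_metric_triangle[OF G])

section \<open>Closed curves are at least as long as the norm of their class\<close>

lemma path_collapse_curve:
  fixes G :: "('v::finite, 'e::finite) wgraph"
  assumes G: "weighted_graph G" and \<gamma>: "pathin (graph_topology G) \<gamma>"
  shows "path (collapse G e \<circ> \<gamma>)"
proof -
  interpret Metric_space "points G" "length_metric G" by (rule Metric_space_length_metric[OF G])
  have "continuous_map mtopology Met_TC.mtopology (collapse G e)"
    unfolding metric_continuous_map[OF Met_TC.Metric_space_axioms]
  proof (intro conjI ballI allI impI)
    fix x and \<epsilon> :: real assume x: "x \<in> points G" and \<epsilon>: "\<epsilon> > 0"
    let ?K = "2 * pi / weight G e"
    have K: "?K > 0" using weighted_graph_weight_pos[OF G] by simp
    show "\<exists>\<delta>>0. \<forall>y. y \<in> points G \<and> length_metric G x y < \<delta> \<longrightarrow> dist (collapse G e x) (collapse G e y) < \<epsilon>"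
    proof (intro exI[of _ "\<epsilon> / ?K"] conjI allI impI)
      show "\<epsilon> / ?K > 0" using \<epsilon> K by (rule divide_pos_pos)
      fix y assume y: "y \<in> points G \<and> length_metric G x y < \<epsilon> / ?K"
      then have "?K * length_metric G x y < \<epsilon>"
        using K pos_less_divide_eq[OF K] by (simp add: mult.commute)
      then show "dist (collapse G e x) (collapse G e y) < \<epsilon>"
        using collapse_Lipschitz[OF G x, of y e] y by linarith
    qed
  qed auto
  then have "continuous_map mtopology euclidean (collapse G e)" by simp
  with \<gamma> have "pathin euclidean (collapse G e \<circ> \<gamma>)"
    unfolding graph_topology_def by (rule pathin_compose)
  then show ?thesis by (simp add: pathin_def path_def)
qed

lemma curve_in_points:
  fixes G :: "('v::finite, 'e::finite) wgraph"
  assumes G: "weighted_graph G" and \<gamma>: "pathin (graph_topology G) \<gamma>" and "t \<in> {0..1}"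
  shows "\<gamma> t \<in> points G"
proof -
  interpret Metric_space "points G" "length_metric G" by (rule Metric_space_length_metric[OF G])
  show ?thesis
    using continuous_map_image_subset_topspace[OF \<gamma>[unfolded graph_topology_def pathin_def]]
      \<open>t \<in> {0..1}\<close> by (auto simp del: image_subset_iff)
qed

text \<open>
  The partition must be so fine that none of the arguments \<open>\<theta> e\<close> changes by more than \<open>pi\<close> in one
  step; putting them together into the vector \<open>\<Theta>\<close> makes one modulus of continuity serve for all.
\<close>

lemma curve_length_ge:
  fixes G :: "('v::finite, 'e::finite) wgraph"
  assumes G: "weighted_graph G" and \<gamma>: "pathin (graph_topology G) \<gamma>"
  shows "ennreal (weighted_l1 G (homology_class G \<gamma>)) \<le> curve_length G \<gamma>"
proof -
  have norm1: "norm (collapse G e p) = 1" for e p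
    by (auto simp: collapse_def split: point.splits)
  have "\<exists>\<theta>. continuous_on {0..1} \<theta> \<and> (\<forall>t\<in>{0..1}. collapse G e (\<gamma> t) = cis (\<theta> t)) \<and>
      \<theta> 1 - \<theta> 0 = 2 * pi * homology_class G \<gamma> $ e" for e
  proof -
    have "path (collapse G e \<circ> \<gamma>)" by (rule path_collapse_curve[OF assms])
    moreover have "0 \<notin> path_image (collapse G e \<circ> \<gamma>)"
    proof -
      have "collapse G e p \<noteq> 0" for p using norm1[of e p] by force
      then show ?thesis by (auto simp: path_image_def)
    qed
    ultimately obtain q where q: "path q"
      "pathfinish q - pathstart q = 2 * of_real pi * \<i> * winding_number (collapse G e \<circ> \<gamma>) 0"
      "\<And>t. t \<in> {0..1} \<Longrightarrow> (collapse G e \<circ> \<gamma>) t = 0 + exp (q t)"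
      by (rule winding_number_as_continuous_log) blast
    have "continuous_on {0..1} (\<lambda>t. Im (q t))"
      using q(1) by (intro continuous_intros) (simp add: path_def)
    moreover have "collapse G e (\<gamma> t) = cis (Im (q t))" if "t \<in> {0..1}" for t
    proof -
      have "collapse G e (\<gamma> t) = exp (q t)" using q(3)[OF that] by simp
      moreover from this have "Re (q t) = 0" using norm1[of e "\<gamma> t"] by simp
      ultimately show ?thesis using exp_eq_polar[of "q t"] by simp
    qed
    moreover have "Im (q 1) - Im (q 0) = 2 * pi * homology_class G \<gamma> $ e"
      using arg_cong[OF q(2), of Im] by (simp add: pathfinish_def pathstart_def homology_class_def)
    ultimately show ?thesis by blast
  qed
  then have "\<forall>e. \<exists>\<theta>. continuous_on {0..1} \<theta> \<and> (\<forall>t\<in>{0..1}. collapse G e (\<gamma> t) = cis (\<theta> t)) \<and>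
      \<theta> 1 - \<theta> 0 = 2 * pi * homology_class G \<gamma> $ e" by blast
  from choice[OF this] obtain \<theta> where \<theta>: "\<And>e. continuous_on {0..1} (\<theta> e)"
    "\<And>e t. t \<in> {0..1} \<Longrightarrow> collapse G e (\<gamma> t) = cis (\<theta> e t)"
    "\<And>e. \<theta> e 1 - \<theta> e 0 = 2 * pi * homology_class G \<gamma> $ e"
    by blast
  define \<Theta> where "\<Theta> t = (\<chi> e. \<theta> e t)" for t
  have "continuous_on {0..1} \<Theta>" unfolding \<Theta>_def using \<theta>(1) by (intro continuous_on_vec_lambda)
  then have "uniformly_continuous_on {0..1} \<Theta>" by (intro compact_uniformly_continuous) auto
  then obtain \<delta> where \<delta>: "\<delta> > 0"
    "\<And>s t. s \<in> {0..1} \<Longrightarrow> t \<in> {0..1} \<Longrightarrow> dist t s < \<delta> \<Longrightarrow> dist (\<Theta> t) (\<Theta> s) < pi"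
    unfolding uniformly_continuous_on_def using pi_gt_zero by blast
  obtain N where N: "inverse (real (Suc N)) < \<delta>" using reals_Archimedean[OF \<delta>(1)] by blast
  define n where "n = Suc N"
  define t where "t i = min 1 (real i / real n)" for i
  have n: "real n > 0" by (simp add: n_def)
  have t_ends: "t n = 1" "t 0 = 0" using n by (simp_all add: t_def)
  have t01: "t i \<in> {0..1}" for i by (simp add: t_def)
  have step: "dist (t (Suc i)) (t i) < \<delta>" for i
  proof -
    have "dist (t (Suc i)) (t i) \<le> \<bar>real (Suc i) / real n - real i / real n\<bar>"
      unfolding t_def dist_real_def by linarith
    also have "\<dots> = inverse (real (Suc N))"
      by (simp add: n_def diff_divide_distrib[symmetric] inverse_eq_divide)
    finally show ?thesis using N by simp
  qed
  have "weight G e * \<bar>homology_class G \<gamma> $ e\<bar> \<le>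
      (\<Sum>i<n. weight G e / (2 * pi) * \<bar>\<theta> e (t (Suc i)) - \<theta> e (t i)\<bar>)" for e
  proof -
    have "2 * pi * \<bar>homology_class G \<gamma> $ e\<bar> = \<bar>\<theta> e 1 - \<theta> e 0\<bar>"
      by (simp add: \<theta>(3) abs_mult)
    also have "\<dots> = \<bar>\<Sum>i<n. \<theta> e (t (Suc i)) - \<theta> e (t i)\<bar>"
      unfolding sum_lessThan_telescope[of "\<lambda>i. \<theta> e (t i)"] t_ends ..
    also have "\<dots> \<le> (\<Sum>i<n. \<bar>\<theta> e (t (Suc i)) - \<theta> e (t i)\<bar>)" by (rule sum_abs)
    finally have "weight G e / (2 * pi) * (2 * pi * \<bar>homology_class G \<gamma> $ e\<bar>) \<le>
        weight G e / (2 * pi) * (\<Sum>i<n. \<bar>\<theta> e (t (Suc i)) - \<theta> e (t i)\<bar>)"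
      using weighted_graph_weight_pos[OF G, of e] by (intro mult_left_mono) auto
    then show ?thesis by (simp add: sum_distrib_left)
  qed
  then have "weighted_l1 G (homology_class G \<gamma>) \<le>
      (\<Sum>e\<in>UNIV. \<Sum>i<n. weight G e / (2 * pi) * \<bar>\<theta> e (t (Suc i)) - \<theta> e (t i)\<bar>)"
    unfolding weighted_l1_def by (intro sum_mono)
  also have "\<dots> = (\<Sum>i<n. \<Sum>e\<in>UNIV. weight G e / (2 * pi) * \<bar>\<theta> e (t (Suc i)) - \<theta> e (t i)\<bar>)"
    by (rule sum.swap)
  also have "\<dots> \<le> (\<Sum>i<n. length_metric G (\<gamma> (t i)) (\<gamma> (t (Suc i))))"
  proof (intro sum_mono length_metric_ge_lift[OF G])
    fix i e
    show "\<gamma> (t i) \<in> points G" "\<gamma> (t (Suc i)) \<in> points G"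
      using curve_in_points[OF assms] t01 by blast+
    show "collapse G e (\<gamma> (t i)) = cis (\<theta> e (t i))"
      "collapse G e (\<gamma> (t (Suc i))) = cis (\<theta> e (t (Suc i)))"
      using \<theta>(2) t01 by blast+
    have "dist (\<Theta> (t (Suc i))) (\<Theta> (t i)) < pi" using \<delta>(2) t01 step by blast
    then show "\<bar>\<theta> e (t (Suc i)) - \<theta> e (t i)\<bar> \<le> pi"
      using component_le_norm_cart[of "\<Theta> (t (Suc i)) - \<Theta> (t i)" e] by (simp add: \<Theta>_def dist_norm)
  qed
  finally have "ennreal (weighted_l1 G (homology_class G \<gamma>)) \<le>
      ennreal (\<Sum>i<n. length_metric G (\<gamma> (t i)) (\<gamma> (t (Suc i))))"
    by (rule ennreal_leI)
  also have "\<dots> \<le> curve_length G \<gamma>"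
  proof -
    have "mono t" unfolding t_def by (intro monoI min.mono divide_right_mono) auto
    then have "t \<in> {t. mono t \<and> range t \<subseteq> {0..1}}" using t01 by auto
    then show ?thesis
      unfolding curve_length_def by (intro SUP_upper2[of n] SUP_upper2[of t]) auto
  qed
  finally show ?thesis .
qed

section \<open>Short closed curves in the multiples of an integer class\<close>

text \<open>
  A curve from \<open>u\<close> to \<open>v\<close>, parametrized on \<open>{0..l}\<close> with speed at most \<open>1\<close>. The arguments \<open>\<theta> e\<close> of
  its images under the collapse maps are part of the data, so that the class \<open>c\<close> is read off from
  their end values and adds up under concatenation, even for curves that are not closed.
\<close>

definition curve_between ::
    "('v, 'e::finite) wgraph \<Rightarrow> 'v \<Rightarrow> real \<Rightarrow> real ^ 'e \<Rightarrow> 'v \<Rightarrow> bool" where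
  "curve_between G u l c v \<longleftrightarrow> 0 \<le> l \<and> (\<exists>\<gamma> \<theta>.
     \<gamma> 0 = Vertex u \<and> \<gamma> l = Vertex v \<and>
     (\<forall>t\<in>{0..l}. \<gamma> t \<in> points G) \<and>
     (\<forall>s\<in>{0..l}. \<forall>t\<in>{0..l}. s \<le> t \<longrightarrow> length_metric G (\<gamma> s) (\<gamma> t) \<le> t - s) \<and>
     (\<forall>e. continuous_on {0..l} (\<theta> e) \<and> \<theta> e 0 = 0 \<and> \<theta> e l = 2 * pi * c $ e \<and>
       (\<forall>t\<in>{0..l}. collapse G e (\<gamma> t) = cis (\<theta> e t))))"

lemma curve_betweenI:
  assumes "0 \<le> l" "\<gamma> 0 = Vertex u" "\<gamma> l = Vertex v"
    and "\<And>t. t \<in> {0..l} \<Longrightarrow> \<gamma> t \<in> points G"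
    and "\<And>s t. s \<in> {0..l} \<Longrightarrow> t \<in> {0..l} \<Longrightarrow> s \<le> t \<Longrightarrow> length_metric G (\<gamma> s) (\<gamma> t) \<le> t - s"
    and "\<And>e. continuous_on {0..l} (\<theta> e)"
    and "\<And>e. \<theta> e 0 = 0" "\<And>e. \<theta> e l = 2 * pi * c $ e"
    and "\<And>e t. t \<in> {0..l} \<Longrightarrow> collapse G e (\<gamma> t) = cis (\<theta> e t)"
  shows "curve_between G u l c v"
  unfolding curve_between_def using assms by (intro conjI exI[of _ \<gamma>] exI[of _ \<theta>]) auto

lemma curve_betweenE:
  assumes "curve_between G u l c v"
  obtains \<gamma> \<theta> where "0 \<le> l" "\<gamma> 0 = Vertex u" "\<gamma> l = Vertex v"
    "\<And>t. t \<in> {0..l} \<Longrightarrow> \<gamma> t \<in> points G"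
    "\<And>s t. s \<in> {0..l} \<Longrightarrow> t \<in> {0..l} \<Longrightarrow> s \<le> t \<Longrightarrow> length_metric G (\<gamma> s) (\<gamma> t) \<le> t - s"
    "\<And>e. continuous_on {0..l} (\<theta> e)"
    "\<And>e. \<theta> e 0 = 0" "\<And>e. \<theta> e l = 2 * pi * c $ e"
    "\<And>e t. t \<in> {0..l} \<Longrightarrow> collapse G e (\<gamma> t) = cis (\<theta> e t)"
  using assms unfolding curve_between_def by blast

lemma curve_between_refl:
  fixes G :: "('v::finite, 'e::finite) wgraph"
  shows "curve_between G u 0 0 u"
proof (rule curve_betweenI[of _ "\<lambda>_. Vertex u" _ _ _ "\<lambda>_ _. 0"])
  have u: "Vertex u \<in> points G" by (simp add: points_def)
  show "length_metric G (Vertex u) (Vertex u) \<le> t - s" if "s \<in> {0..0}" "t \<in> {0..0}" for s t :: real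
    using length_metric_le[OF u u joined.refl] that by simp
qed (auto simp: points_def collapse_def)

lemma curve_between_edge:
  fixes G :: "('v::finite, 'e::finite) wgraph"
  assumes G: "weighted_graph G"
  shows "curve_between G (src G e) (weight G e) (axis e 1) (tgt G e)"
proof (rule curve_betweenI[of _ "edge_point G e" _ _ _
      "\<lambda>f t. if f = e then 2 * pi * t / weight G e else 0"])
  note w = weighted_graph_weight_pos[OF G, of e]
  show "0 \<le> weight G e" using w by simp
  show "edge_point G e 0 = Vertex (src G e)" "edge_point G e (weight G e) = Vertex (tgt G e)"
    by (simp_all add: edge_point_ends[OF G])
  show "edge_point G e t \<in> points G" if "t \<in> {0..weight G e}" for t
    using that by (rule edge_point_in_points)
  show "length_metric G (edge_point G e s) (edge_point G e t) \<le> t - s"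
    if "s \<in> {0..weight G e}" "t \<in> {0..weight G e}" "s \<le> t" for s t
    using length_metric_le[OF edge_point_in_points edge_point_in_points joined_segment, OF that(1,2,1,2)]
      that(3) by simp
  show "continuous_on {0..weight G e} (\<lambda>t. if f = e then 2 * pi * t / weight G e else 0)" for f
    using w by (cases "f = e") (auto intro!: continuous_intros)
  show "collapse G f (edge_point G e t) = cis (if f = e then 2 * pi * t / weight G e else 0)"
    if "t \<in> {0..weight G e}" for f t
    using collapse_edge_point[OF G that, of f] by simp
qed (use weighted_graph_weight_pos[OF G, of e] in \<open>auto simp: axis_def\<close>)

lemma curve_between_reverse:
  fixes G :: "('v::finite, 'e::finite) wgraph"
  assumes G: "weighted_graph G" and "curve_between G u l c v"
  shows "curve_between G v l (- c) u"
proof -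
  interpret Metric_space "points G" "length_metric G" by (rule Metric_space_length_metric[OF G])
  obtain \<gamma> \<theta> where \<gamma>: "0 \<le> l" "\<gamma> 0 = Vertex u" "\<gamma> l = Vertex v"
    "\<And>t. t \<in> {0..l} \<Longrightarrow> \<gamma> t \<in> points G"
    "\<And>s t. s \<in> {0..l} \<Longrightarrow> t \<in> {0..l} \<Longrightarrow> s \<le> t \<Longrightarrow> length_metric G (\<gamma> s) (\<gamma> t) \<le> t - s"
    and \<theta>: "\<And>e. continuous_on {0..l} (\<theta> e)"
    "\<And>e. \<theta> e 0 = 0" "\<And>e. \<theta> e l = 2 * pi * c $ e"
    "\<And>e t. t \<in> {0..l} \<Longrightarrow> collapse G e (\<gamma> t) = cis (\<theta> e t)"
    using assms(2) by (rule curve_betweenE) blast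
  show ?thesis
  proof (rule curve_betweenI[of _ "\<lambda>t. \<gamma> (l - t)" _ _ _ "\<lambda>e t. \<theta> e (l - t) - \<theta> e l"])
    show "length_metric G (\<gamma> (l - s)) (\<gamma> (l - t)) \<le> t - s"
      if "s \<in> {0..l}" "t \<in> {0..l}" "s \<le> t" for s t
      using \<gamma>(5)[of "l - t" "l - s"] that by (simp add: commute)
    show "continuous_on {0..l} (\<lambda>t. \<theta> e (l - t) - \<theta> e l)" for e
      by (intro continuous_intros continuous_on_compose2[OF \<theta>(1)]) auto
    show "collapse G e (\<gamma> (l - t)) = cis (\<theta> e (l - t) - \<theta> e l)" if "t \<in> {0..l}" for e t
    proof -
      have "cis (\<theta> e l) = 1" using \<theta>(4)[of l e] \<gamma>(1,3) by (simp add: collapse_def)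
      then show ?thesis using \<theta>(4)[of "l - t" e] that by (simp add: cis_divide[symmetric])
    qed
  qed (use \<gamma>(1-4) \<theta>(2,3) in auto)
qed

text \<open>
  Since \<open>v\<close> is a vertex, \<open>\<theta> e l\<close> is a multiple of \<open>2 * pi\<close>, and adding it to the second argument
  function does not change its image on the circle.
\<close>

lemma curve_between_trans:
  fixes G :: "('v::finite, 'e::finite) wgraph"
  assumes G: "weighted_graph G" and "curve_between G u l c v" and "curve_between G v m d w"
  shows "curve_between G u (l + m) (c + d) w"
proof -
  interpret Metric_space "points G" "length_metric G" by (rule Metric_space_length_metric[OF G])
  obtain \<gamma> \<theta> where \<gamma>: "0 \<le> l" "\<gamma> 0 = Vertex u" "\<gamma> l = Vertex v"
    "\<And>t. t \<in> {0..l} \<Longrightarrow> \<gamma> t \<in> points G"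
    "\<And>s t. s \<in> {0..l} \<Longrightarrow> t \<in> {0..l} \<Longrightarrow> s \<le> t \<Longrightarrow> length_metric G (\<gamma> s) (\<gamma> t) \<le> t - s"
    and \<theta>: "\<And>e. continuous_on {0..l} (\<theta> e)"
    "\<And>e. \<theta> e 0 = 0" "\<And>e. \<theta> e l = 2 * pi * c $ e"
    "\<And>e t. t \<in> {0..l} \<Longrightarrow> collapse G e (\<gamma> t) = cis (\<theta> e t)"
    using assms(2) by (rule curve_betweenE) blast
  obtain \<gamma>' \<theta>' where \<gamma>': "0 \<le> m" "\<gamma>' 0 = Vertex v" "\<gamma>' m = Vertex w"
    "\<And>t. t \<in> {0..m} \<Longrightarrow> \<gamma>' t \<in> points G"
    "\<And>s t. s \<in> {0..m} \<Longrightarrow> t \<in> {0..m} \<Longrightarrow> s \<le> t \<Longrightarrow> length_metric G (\<gamma>' s) (\<gamma>' t) \<le> t - s"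
    and \<theta>': "\<And>e. continuous_on {0..m} (\<theta>' e)"
    "\<And>e. \<theta>' e 0 = 0" "\<And>e. \<theta>' e m = 2 * pi * d $ e"
    "\<And>e t. t \<in> {0..m} \<Longrightarrow> collapse G e (\<gamma>' t) = cis (\<theta>' e t)"
    using assms(3) by (rule curve_betweenE) blast
  define \<eta> where "\<eta> t = (if t \<le> l then \<gamma> t else \<gamma>' (t - l))" for t
  define \<phi> where "\<phi> e t = (if t \<le> l then \<theta> e t else \<theta> e l + \<theta>' e (t - l))" for e t
  have \<eta>2: "\<eta> t = \<gamma>' (t - l)" if "l \<le> t" for t
    using that \<gamma>(3) \<gamma>'(2) by (cases "t = l") (auto simp: \<eta>_def)
  have \<phi>2: "\<phi> e t = \<theta> e l + \<theta>' e (t - l)" if "l \<le> t" for e t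
    using that \<theta>'(2) by (cases "t = l") (auto simp: \<phi>_def)
  have in_points: "\<eta> t \<in> points G" if "t \<in> {0..l + m}" for t
    using that \<gamma>(4)[of t] \<gamma>'(4)[of "t - l"] by (auto simp: \<eta>_def)
  show ?thesis
  proof (rule curve_betweenI[of _ \<eta> _ _ _ \<phi>])
    show "0 \<le> l + m" using \<gamma>(1) \<gamma>'(1) by simp
    show "\<eta> 0 = Vertex u" using \<gamma>(1,2) by (simp add: \<eta>_def)
    show "\<eta> (l + m) = Vertex w" using \<eta>2[of "l + m"] \<gamma>'(1,3) by simp
    show "\<eta> t \<in> points G" if "t \<in> {0..l + m}" for t using that by (rule in_points)
    show "length_metric G (\<eta> s) (\<eta> t) \<le> t - s"
      if s: "s \<in> {0..l + m}" and t: "t \<in> {0..l + m}" and st: "s \<le> t" for s t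
    proof -
      consider "t \<le> l" | "l \<le> s" | "s \<le> l" "l \<le> t" by linarith
      then show ?thesis
      proof cases
        case 1
        then show ?thesis using \<gamma>(5)[of s t] s t st by (simp add: \<eta>_def)
      next
        case 2
        then show ?thesis using \<gamma>'(5)[of "s - l" "t - l"] s t st by (simp add: \<eta>2)
      next
        case 3
        have "length_metric G (\<eta> s) (\<eta> t) \<le> length_metric G (\<eta> s) (\<eta> l) + length_metric G (\<eta> l) (\<eta> t)"
          using s t \<gamma>(1) \<gamma>'(1) by (intro triangle in_points) auto
        moreover have "length_metric G (\<eta> s) (\<eta> l) \<le> l - s"
          using \<gamma>(5)[of s l] 3 s \<gamma>(1) by (simp add: \<eta>_def)
        moreover have "length_metric G (\<eta> l) (\<eta> t) \<le> t - l"
          using \<gamma>'(5)[of 0 "t - l"] 3 t \<gamma>'(1) by (simp add: \<eta>2)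
        ultimately show ?thesis by linarith
      qed
    qed
    show "continuous_on {0..l + m} (\<phi> e)" for e
    proof -
      have "continuous_on ({0..l} \<union> {l..l + m}) (\<lambda>t. if t \<le> l then \<theta> e t else \<theta> e l + \<theta>' e (t - l))"
      proof (rule continuous_on_cases)
        show "continuous_on {l..l + m} (\<lambda>t. \<theta> e l + \<theta>' e (t - l))"
          by (intro continuous_intros continuous_on_compose2[OF \<theta>'(1)]) auto
      qed (use \<theta>(1) \<theta>'(2) in auto)
      moreover have "{0..l} \<union> {l..l + m} = {0..l + m}" using \<gamma>(1) \<gamma>'(1) by auto
      ultimately show ?thesis unfolding \<phi>_def by simp
    qed
    show "\<phi> e 0 = 0" for e using \<gamma>(1) \<theta>(2) by (simp add: \<phi>_def)
    show "\<phi> e (l + m) = 2 * pi * (c + d) $ e" for e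
      using \<phi>2[of "l + m" e] \<gamma>'(1) \<theta>(3) \<theta>'(3) by (simp add: distrib_left)
    show "collapse G e (\<eta> t) = cis (\<phi> e t)" if t: "t \<in> {0..l + m}" for e t
    proof (cases "t \<le> l")
      case True
      then show ?thesis using \<theta>(4)[of t e] t by (simp add: \<eta>_def \<phi>_def)
    next
      case False
      have "cis (\<theta> e l) = 1" using \<theta>(4)[of l e] \<gamma>(1,3) by (simp add: collapse_def)
      then show ?thesis using \<theta>'(4)[of "t - l" e] t False
        by (simp add: \<eta>2 \<phi>2 cis_mult[symmetric])
    qed
  qed
qed

lemma minimal_length_le:
  fixes G :: "('v::finite, 'e::finite) wgraph"
  assumes G: "weighted_graph G" and "curve_between G u l c u"
  shows "minimal_length G c \<le> ennreal l"
proof -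
  interpret Metric_space "points G" "length_metric G" by (rule Metric_space_length_metric[OF G])
  obtain \<gamma> \<theta> where \<gamma>: "0 \<le> l" "\<gamma> 0 = Vertex u" "\<gamma> l = Vertex u"
    "\<And>t. t \<in> {0..l} \<Longrightarrow> \<gamma> t \<in> points G"
    "\<And>s t. s \<in> {0..l} \<Longrightarrow> t \<in> {0..l} \<Longrightarrow> s \<le> t \<Longrightarrow> length_metric G (\<gamma> s) (\<gamma> t) \<le> t - s"
    and \<theta>: "\<And>e. continuous_on {0..l} (\<theta> e)"
    "\<And>e. \<theta> e 0 = 0" "\<And>e. \<theta> e l = 2 * pi * c $ e"
    "\<And>e t. t \<in> {0..l} \<Longrightarrow> collapse G e (\<gamma> t) = cis (\<theta> e t)"
    using assms(2) by (rule curve_betweenE) blast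
  define \<eta> where "\<eta> t = \<gamma> (l * t)" for t
  have scale: "l * t \<in> {0..l}" if "t \<in> {0..1}" for t
    using that \<gamma>(1) by (auto simp: mult_left_le)
  have points: "\<eta> t \<in> points G" if "t \<in> {0..1}" for t
    using \<gamma>(4)[OF scale[OF that]] by (simp add: \<eta>_def)
  have Lip: "length_metric G (\<eta> s) (\<eta> t) \<le> l * (t - s)"
    if "s \<in> {0..1}" "t \<in> {0..1}" "s \<le> t" for s t
    using \<gamma>(5)[OF scale[OF that(1)] scale[OF that(2)]] that(3) \<gamma>(1)
    by (simp add: \<eta>_def mult_left_mono right_diff_distrib)
  have Lip': "length_metric G (\<eta> s) (\<eta> t) \<le> l * \<bar>t - s\<bar>" if "s \<in> {0..1}" "t \<in> {0..1}" for s t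
    using Lip[OF that] Lip[OF that(2,1)] commute[of "\<eta> s" "\<eta> t"]
    by (cases "s \<le> t") (auto simp: abs_if)
  have "pathin (graph_topology G) \<eta>"
    unfolding pathin_def graph_topology_def continuous_map_to_metric
  proof (intro ballI allI impI)
    fix s \<epsilon> :: real assume s: "s \<in> topspace (top_of_set {0..1})" and \<epsilon>: "\<epsilon> > 0"
    let ?U = "{0..1} \<inter> ball s (\<epsilon> / (l + 1))"
    have "\<eta> t \<in> mball (\<eta> s) \<epsilon>" if t: "t \<in> ?U" for t
    proof -
      have "\<bar>t - s\<bar> < \<epsilon> / (l + 1)" using t by (simp add: dist_real_def abs_minus_commute)
      then have "(l + 1) * \<bar>t - s\<bar> < \<epsilon>" using \<gamma>(1) by (simp add: field_simps)
      moreover have "l * \<bar>t - s\<bar> \<le> (l + 1) * \<bar>t - s\<bar>" by (intro mult_right_mono) auto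
      ultimately show ?thesis using Lip'[of s t] s t points by auto
    qed
    moreover have "openin (top_of_set {0..1}) ?U" by (intro openin_open_Int) simp
    moreover have "s \<in> ?U" using s \<epsilon> \<gamma>(1) by simp
    ultimately show "\<exists>U. openin (top_of_set {0..1}) U \<and> s \<in> U \<and> (\<forall>t\<in>U. \<eta> t \<in> mball (\<eta> s) \<epsilon>)" by blast
  qed
  then have closed: "closed_curve G \<eta>" using \<gamma>(2,3) by (simp add: closed_curve_def \<eta>_def)
  have "homology_class G \<eta> $ e = c $ e" for e
  proof -
    define p where "p t = \<i> * of_real (\<theta> e (l * t))" for t
    have "path p"
      unfolding path_def p_def using scale
      by (intro continuous_intros continuous_on_compose2[OF \<theta>(1)]) auto
    have "winding_number (collapse G e \<circ> \<eta>) 0 = winding_number (exp \<circ> p) 0"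
      using \<theta>(4)[OF scale] by (intro winding_number_cong) (simp add: \<eta>_def p_def cis_conv_exp)
    also have "\<dots> = (pathfinish p - pathstart p) / (2 * of_real pi * \<i>)"
      by (rule winding_number_compose_exp[OF \<open>path p\<close>])
    also have "\<dots> = of_real (c $ e)"
      by (simp add: p_def pathfinish_def pathstart_def \<theta>(2,3))
    finally show ?thesis by (simp add: homology_class_def)
  qed
  then have "homology_class G \<eta> = c" by (simp add: vec_eq_iff)
  with closed have "minimal_length G c \<le> curve_length G \<eta>"
    unfolding minimal_length_def by (intro INF_lower) simp
  also have "curve_length G \<eta> \<le> ennreal l"
    unfolding curve_length_def
  proof (intro SUP_least ennreal_leI)
    fix n and t :: "nat \<Rightarrow> real" assume "t \<in> {t. mono t \<and> range t \<subseteq> {0..1}}"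
    then have t: "mono t" "\<And>i. t i \<in> {0..1}" using range_subsetD[of t] by blast+
    have "(\<Sum>i<n. length_metric G (\<eta> (t i)) (\<eta> (t (Suc i)))) \<le> (\<Sum>i<n. l * (t (Suc i) - t i))"
      using t(1) by (intro sum_mono Lip t(2)) (simp add: mono_def)
    also have "\<dots> = l * (t n - t 0)"
      by (simp add: sum_distrib_left[symmetric] sum_lessThan_telescope)
    also have "\<dots> \<le> l * 1" using t(2)[of n] t(2)[of 0] \<gamma>(1) by (intro mult_left_mono) auto
    finally show "(\<Sum>i<n. length_metric G (\<eta> (t i)) (\<eta> (t (Suc i)))) \<le> l" by simp
  qed
  finally show ?thesis .
qed

subsection \<open>Following the flow of an integer chain\<close>

text \<open>
  On each edge \<open>c\<close> lies between \<open>0\<close> and \<open>r\<close>: the flow \<open>c\<close> is a part of the flow \<open>r\<close>, and the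
  splitting \<open>r = c + (r - c)\<close> has no cancellation.
\<close>

definition sub_chain :: "real ^ 'e \<Rightarrow> real ^ 'e \<Rightarrow> bool" where
  "sub_chain c r \<longleftrightarrow> (\<forall>e. \<bar>r $ e\<bar> = \<bar>c $ e\<bar> + \<bar>r $ e - c $ e\<bar>)"

definition integral_chain :: "real ^ 'e \<Rightarrow> bool" where
  "integral_chain c \<longleftrightarrow> (\<forall>e. c $ e \<in> \<int>)"

lemma sub_chain_step:
  assumes "sub_chain \<delta> r" "sub_chain c (r - \<delta>)"
  shows "sub_chain (\<delta> + c) r" "\<bar>(\<delta> + c) $ e\<bar> = \<bar>\<delta> $ e\<bar> + \<bar>c $ e\<bar>"
proof -
  have *: "\<bar>r $ e\<bar> = \<bar>(\<delta> + c) $ e\<bar> + \<bar>r $ e - (\<delta> + c) $ e\<bar> \<and> \<bar>(\<delta> + c) $ e\<bar> = \<bar>\<delta> $ e\<bar> + \<bar>c $ e\<bar>" for e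
    using assms[unfolded sub_chain_def, rule_format, of e]
    by (simp add: abs_if split: if_splits)
  show "sub_chain (\<delta> + c) r" "\<bar>(\<delta> + c) $ e\<bar> = \<bar>\<delta> $ e\<bar> + \<bar>c $ e\<bar>"
    using * by (auto simp: sub_chain_def)
qed

lemma weighted_l1_sub_chain:
  "sub_chain c r \<Longrightarrow> weighted_l1 G r = weighted_l1 G c + weighted_l1 G (r - c)"
  by (simp add: weighted_l1_def sub_chain_def sum.distrib[symmetric] distrib_left[symmetric])

lemma weighted_l1_sub_chain_step:
  assumes "sub_chain \<delta> r" "sub_chain c (r - \<delta>)"
  shows "weighted_l1 G (\<delta> + c) = weighted_l1 G \<delta> + weighted_l1 G c"
  unfolding weighted_l1_def sub_chain_step(2)[OF assms] by (simp add: sum.distrib distrib_left)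

lemma boundary_axis: "boundary G (axis e 1) = axis (tgt G e) 1 - axis (src G e) 1"
proof -
  have "boundary G (axis e 1) =
      (\<Sum>f\<in>UNIV. if f = e then axis (tgt G f) 1 - axis (src G f) 1 else 0)"
    unfolding boundary_def by (intro sum.cong) (auto simp: axis_def)
  then show ?thesis by simp
qed

lemma boundary_diff: "boundary G (a - c) = boundary G a - boundary G c"
  by (rule linear_diff[OF linear_boundary])

lemma unit_chain_along:
  fixes G :: "('v::finite, 'e::finite) wgraph"
  assumes G: "weighted_graph G" and r: "integral_chain r" and e: "r $ e \<noteq> 0"
  defines "q \<equiv> if r $ e > 0 then src G e else tgt G e"
    and "q' \<equiv> if r $ e > 0 then tgt G e else src G e"
    and "\<delta> \<equiv> (if r $ e > 0 then axis e 1 else - axis e 1) :: real ^ 'e"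
  shows "curve_between G q (weighted_l1 G \<delta>) \<delta> q'" "boundary G \<delta> = axis q' 1 - axis q 1"
    "integral_chain \<delta>" "sub_chain \<delta> r" "(\<Sum>f\<in>UNIV. \<bar>\<delta> $ f\<bar>) = 1"
proof -
  have \<delta>: "\<bar>\<delta> $ f\<bar> = (if f = e then 1 else 0)" for f by (simp add: \<delta>_def axis_def)
  have "weighted_l1 G \<delta> = (\<Sum>f\<in>UNIV. if f = e then weight G f else 0)"
    unfolding weighted_l1_def \<delta> by (intro sum.cong) auto
  then have "weighted_l1 G \<delta> = weight G e" by simp
  then show "curve_between G q (weighted_l1 G \<delta>) \<delta> q'"
    using curve_between_edge[OF G, of e] curve_between_reverse[OF G curve_between_edge[OF G, of e]]
    by (simp add: q_def q'_def \<delta>_def)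
  show "boundary G \<delta> = axis q' 1 - axis q 1"
    using boundary_axis[of G e] linear_neg[OF linear_boundary, of G "axis e 1"]
    by (simp add: q_def q'_def \<delta>_def)
  show "integral_chain \<delta>" by (auto simp: integral_chain_def \<delta>_def axis_def)
  have "1 \<le> \<bar>r $ e\<bar>" using r e by (intro Ints_nonzero_abs_ge1) (auto simp: integral_chain_def)
  then show "sub_chain \<delta> r" by (auto simp: sub_chain_def \<delta>_def axis_def)
  show "(\<Sum>f\<in>UNIV. \<bar>\<delta> $ f\<bar>) = 1" unfolding \<delta> by simp
qed

lemma integral_chain_add: "integral_chain a \<Longrightarrow> integral_chain c \<Longrightarrow> integral_chain (a + c)"
  and integral_chain_diff: "integral_chain a \<Longrightarrow> integral_chain c \<Longrightarrow> integral_chain (a - c)"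
  by (auto simp: integral_chain_def)

lemma sum_abs_sub_chain:
  "sub_chain c r \<Longrightarrow> (\<Sum>e\<in>UNIV. \<bar>r $ e\<bar>) = (\<Sum>e\<in>UNIV. \<bar>c $ e\<bar>) + (\<Sum>e\<in>UNIV. \<bar>(r - c) $ e\<bar>)"
  by (simp add: sub_chain_def sum.distrib[symmetric])

lemma chain_eq_0:
  fixes r :: "real ^ 'e"
  assumes "(\<Sum>e\<in>UNIV. \<bar>r $ e\<bar>) \<le> 0"
  shows "r = 0"
proof -
  have "\<bar>r $ e\<bar> \<le> (\<Sum>e\<in>UNIV. \<bar>r $ e\<bar>)" for e by (intro member_le_sum) auto
  then have "\<bar>r $ e\<bar> \<le> 0" for e using assms by (rule order_trans)
  then show ?thesis by (simp add: vec_eq_iff)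
qed

lemma axis_eq_iff_index: "axis p (1::real) = axis q 1 \<longleftrightarrow> p = q"
  by (metis axis_eq_axis zero_neq_one)

text \<open>
  The flow \<open>r\<close> leaves \<open>q\<close> unless \<open>q = p\<close>, so some edge carries it away from \<open>q\<close>. One step along
  that edge uses up one unit of \<open>r\<close>, which bounds the number of steps; the walk can only end at
  \<open>p\<close>. All steps follow the direction of \<open>r\<close>, so the length of the walk is the norm of its class.
\<close>

lemma follow_flow:
  fixes G :: "('v::finite, 'e::finite) wgraph"
  assumes G: "weighted_graph G" and "integral_chain r" "boundary G r = axis p 1 - axis q 1"
    and "(\<Sum>e\<in>UNIV. \<bar>r $ e\<bar>) \<le> real n"
  shows "\<exists>c. curve_between G q (weighted_l1 G c) c p \<and> integral_chain c \<and>
    boundary G c = axis p 1 - axis q 1 \<and> sub_chain c r"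
  using assms(2-)
proof (induction n arbitrary: r q)
  case (0 r q)
  then have "r = 0" by (intro chain_eq_0) simp
  then have "p = q" using 0(2) linear_0[OF linear_boundary, of G] by (simp add: axis_eq_iff_index)
  then show ?case
    using curve_between_refl[of G q] linear_0[OF linear_boundary, of G]
    by (intro exI[of _ 0]) (simp add: integral_chain_def sub_chain_def)
next
  case (Suc n r q)
  show ?case
  proof (cases "p = q")
    case True
    then show ?thesis
      using curve_between_refl[of G q] linear_0[OF linear_boundary, of G]
      by (intro exI[of _ 0]) (simp add: integral_chain_def sub_chain_def)
  next
    case False
    then have neg: "boundary G r $ q < 0" by (simp add: Suc.prems(2) axis_def)
    have "\<exists>e. r $ e * (of_bool (tgt G e = q) - of_bool (src G e = q)) < 0"
    proof (rule ccontr)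
      assume "\<not> ?thesis"
      then have "0 \<le> boundary G r $ q" unfolding boundary_nth by (intro sum_nonneg) (simp add: not_less)
      with neg show False by simp
    qed
    then obtain e where e: "r $ e * (of_bool (tgt G e = q) - of_bool (src G e = q)) < 0" by blast
    define q' where "q' = (if r $ e > 0 then tgt G e else src G e)"
    define \<delta> :: "real ^ 'e" where "\<delta> = (if r $ e > 0 then axis e 1 else - axis e 1)"
    have q: "q = (if r $ e > 0 then src G e else tgt G e)" and "r $ e \<noteq> 0"
      using e by (auto simp: of_bool_def mult_less_0_iff split: if_splits)
    note \<delta> = unit_chain_along[OF G Suc.prems(1) \<open>r $ e \<noteq> 0\<close>, folded q q'_def \<delta>_def]
    have "\<exists>c. curve_between G q' (weighted_l1 G c) c p \<and> integral_chain c \<and>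
        boundary G c = axis p 1 - axis q' 1 \<and> sub_chain c (r - \<delta>)"
    proof (rule Suc.IH)
      show "integral_chain (r - \<delta>)" by (intro integral_chain_diff Suc.prems(1) \<delta>(3))
      show "boundary G (r - \<delta>) = axis p 1 - axis q' 1"
        by (simp add: boundary_diff \<delta>(2) Suc.prems(2))
      show "(\<Sum>e\<in>UNIV. \<bar>(r - \<delta>) $ e\<bar>) \<le> real n"
        using sum_abs_sub_chain[OF \<delta>(4)] \<delta>(5) Suc.prems(3) by simp
    qed
    then obtain c where c: "curve_between G q' (weighted_l1 G c) c p" "integral_chain c"
      "boundary G c = axis p 1 - axis q' 1" "sub_chain c (r - \<delta>)" by blast
    have "curve_between G q (weighted_l1 G (\<delta> + c)) (\<delta> + c) p"
      unfolding weighted_l1_sub_chain_step[OF \<delta>(4) c(4)]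
      by (rule curve_between_trans[OF G \<delta>(1) c(1)])
    moreover have "boundary G (\<delta> + c) = axis p 1 - axis q 1"
      using linear_add[OF linear_boundary, of G \<delta> c] by (simp add: \<delta>(2) c(3))
    ultimately show ?thesis
      using integral_chain_add[OF \<delta>(3) c(2)] sub_chain_step(1)[OF \<delta>(4) c(4)] by blast
  qed
qed

text \<open>
  After a first step along any edge of the support, the rest of the flow leads back to the starting
  point.
\<close>

lemma exists_closed_sub_chain:
  fixes G :: "('v::finite, 'e::finite) wgraph"
  assumes G: "weighted_graph G" and v: "v \<in> H1_int G" "v \<noteq> 0"
  obtains q c where "curve_between G q (weighted_l1 G c) c q" "c \<in> H1_int G" "sub_chain c v"
    "1 \<le> (\<Sum>e\<in>UNIV. \<bar>c $ e\<bar>)"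
proof -
  have int: "integral_chain v" and bd: "boundary G v = 0"
    using v(1) by (auto simp: H1_int_def H1_real_def integral_chain_def)
  obtain e where e: "v $ e \<noteq> 0" using v(2) by (auto simp: vec_eq_iff)
  define q where "q = (if v $ e > 0 then src G e else tgt G e)"
  define q' where "q' = (if v $ e > 0 then tgt G e else src G e)"
  define \<delta> :: "real ^ 'e" where "\<delta> = (if v $ e > 0 then axis e 1 else - axis e 1)"
  note \<delta> = unit_chain_along[OF G int e, folded q_def q'_def \<delta>_def]
  obtain n where n: "(\<Sum>e\<in>UNIV. \<bar>(v - \<delta>) $ e\<bar>) \<le> real n" using real_arch_simple by blast
  obtain c where c: "curve_between G q' (weighted_l1 G c) c q" "integral_chain c"
      "boundary G c = axis q 1 - axis q' 1" "sub_chain c (v - \<delta>)"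
    using follow_flow[OF G integral_chain_diff[OF int \<delta>(3)] _ n, of q q']
    by (auto simp: boundary_diff bd \<delta>(2))
  show ?thesis
  proof (rule that)
    show "curve_between G q (weighted_l1 G (\<delta> + c)) (\<delta> + c) q"
      unfolding weighted_l1_sub_chain_step[OF \<delta>(4) c(4)]
      by (rule curve_between_trans[OF G \<delta>(1) c(1)])
    show "\<delta> + c \<in> H1_int G"
      using integral_chain_add[OF \<delta>(3) c(2)] linear_add[OF linear_boundary, of G \<delta> c]
      by (simp add: \<delta>(2) c(3) H1_int_def H1_real_def integral_chain_def)
    show "sub_chain (\<delta> + c) v" by (rule sub_chain_step(1)[OF \<delta>(4) c(4)])
    show "1 \<le> (\<Sum>e\<in>UNIV. \<bar>(\<delta> + c) $ e\<bar>)"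
      unfolding sub_chain_step(2)[OF \<delta>(4) c(4)] using \<delta>(5) by (simp add: sum.distrib sum_nonneg)
  qed
qed

lemma exists_curve_between:
  fixes G :: "('v::finite, 'e::finite) wgraph"
  assumes G: "weighted_graph G"
  shows "\<exists>l c. curve_between G u l c v"
proof -
  have "(u, v) \<in> (adjacency G)\<^sup>*" using G by (simp add: weighted_graph_def)
  then show ?thesis
  proof (induction rule: rtrancl_induct)
    case base
    show ?case using curve_between_refl by blast
  next
    case (step v w)
    from step(2) have "\<exists>l c. curve_between G v l c w"
      using curve_between_edge[OF G] curve_between_reverse[OF G curve_between_edge[OF G]]
      by (auto simp: adjacency_def)
    with step(3) show ?case using curve_between_trans[OF G] by blast
  qed
qed

lemma curve_between_iterate:
  fixes G :: "('v::finite, 'e::finite) wgraph"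
  assumes G: "weighted_graph G" and "curve_between G q l c q"
  shows "curve_between G q (real k * l) (real k *\<^sub>R c) q"
proof (induction k)
  case (Suc k)
  show ?case using curve_between_trans[OF G assms(2) Suc.IH] by (simp add: algebra_simps)
qed (simp add: curve_between_refl)

text \<open>
  Split off one closed walk from \<open>v\<close>, iterate it \<open>k\<close> times, and join it to the base point \<open>x\<close> by
  a path run to and fro. The path contributes twice its length to \<open>C\<close>, for every \<open>k\<close>.
\<close>

lemma curves_in_multiples:
  fixes G :: "('v::finite, 'e::finite) wgraph"
  assumes G: "weighted_graph G" and "v \<in> H1_int G"
  shows "\<exists>C. \<forall>k. curve_between G x (real k * weighted_l1 G v + C) (real k *\<^sub>R v) x"
proof -
  obtain n where "(\<Sum>e\<in>UNIV. \<bar>v $ e\<bar>) \<le> real n" using real_arch_simple by blast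
  then show ?thesis using assms(2)
  proof (induction n arbitrary: v)
    case (0 v)
    then have "v = 0" by (intro chain_eq_0) simp
    then show ?case using curve_between_refl[of G x] by (intro exI[of _ 0]) simp
  next
    case (Suc n v)
    show ?case
    proof (cases "v = 0")
      case True
      then show ?thesis using curve_between_refl[of G x] by (intro exI[of _ 0]) simp
    next
      case False
      then obtain q c where c: "curve_between G q (weighted_l1 G c) c q" "c \<in> H1_int G"
        "sub_chain c v" "1 \<le> (\<Sum>e\<in>UNIV. \<bar>c $ e\<bar>)"
        using exists_closed_sub_chain[OF G Suc.prems(2)] by blast
      have "v - c \<in> H1_int G" using Suc.prems(2) c(2) by (auto simp: H1_int_def H1_real_diff)
      moreover have "(\<Sum>e\<in>UNIV. \<bar>(v - c) $ e\<bar>) \<le> real n"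
        using sum_abs_sub_chain[OF c(3)] c(4) Suc.prems(1) by simp
      ultimately obtain C where
        C: "\<And>k. curve_between G x (real k * weighted_l1 G (v - c) + C) (real k *\<^sub>R (v - c)) x"
        using Suc.IH by blast
      obtain m d where d: "curve_between G x m d q" using exists_curve_between[OF G] by blast
      have "curve_between G x (real k * weighted_l1 G v + (C + 2 * m)) (real k *\<^sub>R v) x" for k
      proof -
        have "curve_between G x ((m + real k * weighted_l1 G c) + m) ((d + real k *\<^sub>R c) + - d) x"
          by (rule curve_between_trans[OF G curve_between_trans[OF G d curve_between_iterate[OF G c(1)]]
                curve_between_reverse[OF G d]])
        from curve_between_trans[OF G this C[of k]]
        show ?thesis
          unfolding weighted_l1_sub_chain[OF c(3)] by (simp add: algebra_simps)
      qed
      then show ?thesis by blast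
    qed
  qed
qed

section \<open>The stable norm\<close>

lemma weighted_l1_le_minimal_length:
  fixes G :: "('v::finite, 'e::finite) wgraph"
  assumes G: "weighted_graph G"
  shows "ennreal (weighted_l1 G c) \<le> minimal_length G c"
  unfolding minimal_length_def
  using curve_length_ge[OF G] by (intro INF_greatest) (auto simp: closed_curve_def)

lemma stable_norm_int_eq:
  fixes G :: "('v::finite, 'e::finite) wgraph"
  assumes G: "weighted_graph G" and v: "v \<in> H1_int G"
  shows "stable_norm_int G v = weighted_l1 G v"
proof -
  let ?L = "weighted_l1 G v" and ?m = "\<lambda>n. enn2real (minimal_length G (real n *\<^sub>R v))"
  obtain C and x :: 'v where C: "\<And>k. curve_between G x (real k * ?L + C) (real k *\<^sub>R v) x"
    using curves_in_multiples[OF G v] by blast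
  have nonneg: "0 \<le> real n * ?L + C" for n using C[of n] by (simp add: curve_between_def)
  have up: "minimal_length G (real n *\<^sub>R v) \<le> ennreal (real n * ?L + C)" for n
    by (rule minimal_length_le[OF G C])
  have upper: "?m n \<le> real n * ?L + C" for n
    using enn2real_mono[OF up[of n]] nonneg[of n] by simp
  have lower: "real n * ?L \<le> ?m n" for n
  proof -
    have "ennreal (real n * ?L) \<le> minimal_length G (real n *\<^sub>R v)"
      using weighted_l1_le_minimal_length[OF G, of "real n *\<^sub>R v"] by (simp add: weighted_l1_scale)
    from enn2real_mono[OF this] show ?thesis
      using up[of n] weighted_l1_nonneg[OF G, of v] by (simp add: le_less_trans ennreal_less_top)
  qed
  have "(\<lambda>n. ?m n / real n) \<longlonglongrightarrow> ?L"
  proof (rule tendsto_sandwich)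
    show "\<forall>\<^sub>F n in sequentially. ?L \<le> ?m n / real n"
    proof (rule eventually_mono[OF eventually_gt_at_top[of 0]])
      fix n :: nat assume "0 < n"
      then show "?L \<le> ?m n / real n" using lower[of n] by (simp add: pos_le_divide_eq mult.commute)
    qed
    show "\<forall>\<^sub>F n in sequentially. ?m n / real n \<le> ?L + C / real n"
    proof (rule eventually_mono[OF eventually_gt_at_top[of 0]])
      fix n :: nat assume n: "0 < n"
      have "?m n / real n \<le> (real n * ?L + C) / real n" using upper by (rule divide_right_mono) simp
      then show "?m n / real n \<le> ?L + C / real n" using n by (simp add: add_divide_distrib)
    qed
    show "(\<lambda>n. ?L + C / real n) \<longlonglongrightarrow> ?L"
      using tendsto_add[OF tendsto_const lim_const_over_n[of C], of ?L] by simp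
  qed simp
  then show ?thesis unfolding stable_norm_int_def by (rule limI)
qed

lemma rational_approximation:
  fixes G :: "('v::finite, 'e::finite) wgraph"
  assumes u: "u \<in> H1_real G"
  obtains z where "\<And>n. z n \<in> H1_int G" "(\<lambda>n. (1 / real n) *\<^sub>R z n) \<longlonglongrightarrow> u"
proof -
  obtain B \<zeta> where B: "cycle_basis G B \<zeta>" by (rule exists_cycle_basis)
  define z where "z n = (\<Sum>b\<in>B. of_int \<lfloor>real n * u $ b\<rfloor> *\<^sub>R \<zeta> b)" for n
  have "z n \<in> H1_int G" for n
    using B cycle_basis_combination_in[OF B] cycle_basis_combination_nth[OF B]
    by (intro integral_if_integral_on_determining[of G B]) (auto simp: cycle_basis_def z_def)
  moreover have "(\<lambda>n. (1 / real n) *\<^sub>R z n) \<longlonglongrightarrow> (\<Sum>b\<in>B. u $ b *\<^sub>R \<zeta> b)"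
  proof -
    have "(\<lambda>n. of_int \<lfloor>real n * a\<rfloor> / real n) \<longlonglongrightarrow> a" for a :: real
    proof (rule tendsto_sandwich)
      show "\<forall>\<^sub>F n in sequentially. a - 1 / real n \<le> of_int \<lfloor>real n * a\<rfloor> / real n"
        using eventually_gt_at_top[of 0]
      proof eventually_elim
        case (elim n)
        have "real n * a - 1 \<le> of_int \<lfloor>real n * a\<rfloor>" by linarith
        then have "(real n * a - 1) / real n \<le> of_int \<lfloor>real n * a\<rfloor> / real n"
          by (intro divide_right_mono) auto
        then show ?case using elim by (simp add: diff_divide_distrib)
      qed
      show "\<forall>\<^sub>F n in sequentially. of_int \<lfloor>real n * a\<rfloor> / real n \<le> a"
        using eventually_gt_at_top[of 0]
      proof eventually_elim
        case (elim n)
        have "of_int \<lfloor>real n * a\<rfloor> \<le> real n * a" by linarith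
        then have "of_int \<lfloor>real n * a\<rfloor> / real n \<le> (real n * a) / real n"
          by (intro divide_right_mono) auto
        then show ?case using elim by simp
      qed
      show "(\<lambda>n. a - 1 / real n) \<longlonglongrightarrow> a"
        using tendsto_diff[OF tendsto_const lim_const_over_n[of 1], of a] by simp
    qed simp
    then have "(\<lambda>n. \<Sum>b\<in>B. (of_int \<lfloor>real n * u $ b\<rfloor> / real n) *\<^sub>R \<zeta> b) \<longlonglongrightarrow> (\<Sum>b\<in>B. u $ b *\<^sub>R \<zeta> b)"
      by (intro tendsto_sum tendsto_scaleR tendsto_const)
    then show ?thesis by (simp add: z_def scaleR_sum_right)
  qed
  ultimately show ?thesis
    using that[of z] cycle_basis_expansion[OF B u, symmetric] by simp
qed

text \<open>
  The conditions that define the stable norm leave no choice: homogeneity determines it on rational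
  multiples of integer classes, which are dense in \<open>H1_real G\<close>, and continuity does the rest.
\<close>

lemma stable_norm_eq:
  fixes G :: "('v::finite, 'e::finite) wgraph"
  assumes G: "weighted_graph G"
  shows "stable_norm G = (\<lambda>u. if u \<in> H1_real G then weighted_l1 G u else 0)"
  unfolding stable_norm_def
proof (rule the_equality)
  let ?N = "\<lambda>u. if u \<in> H1_real G then weighted_l1 G u else 0"
  have "continuous_on (H1_real G) ?N"
    using continuous_on_weighted_l1[of "H1_real G" G] by (rule continuous_on_eq) simp
  then show "(\<forall>v\<in>H1_int G. ?N v = stable_norm_int G v) \<and>
      (\<forall>u\<in>H1_real G. \<forall>c. ?N (c *\<^sub>R u) = \<bar>c\<bar> * ?N u) \<and>
      continuous_on (H1_real G) ?N \<and> (\<forall>u. u \<notin> H1_real G \<longrightarrow> ?N u = 0)"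
    using stable_norm_int_eq[OF G]
    by (auto simp: H1_int_def H1_real_scale weighted_l1_scale)
  fix N
  assume N: "(\<forall>v\<in>H1_int G. N v = stable_norm_int G v) \<and>
      (\<forall>u\<in>H1_real G. \<forall>c. N (c *\<^sub>R u) = \<bar>c\<bar> * N u) \<and>
      continuous_on (H1_real G) N \<and> (\<forall>u. u \<notin> H1_real G \<longrightarrow> N u = 0)"
  have "N u = weighted_l1 G u" if u: "u \<in> H1_real G" for u
  proof -
    obtain z where z: "\<And>n. z n \<in> H1_int G" "(\<lambda>n. (1 / real n) *\<^sub>R z n) \<longlonglongrightarrow> u"
      using rational_approximation[OF u] by blast
    have zH: "z n \<in> H1_real G" for n using z(1) by (simp add: H1_int_def)
    have "N ((1 / real n) *\<^sub>R z n) = weighted_l1 G ((1 / real n) *\<^sub>R z n)" for n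
      using N z(1)[of n] zH[of n] stable_norm_int_eq[OF G z(1)[of n]] by (simp add: weighted_l1_scale)
    moreover have "(\<lambda>n. N ((1 / real n) *\<^sub>R z n)) \<longlonglongrightarrow> N u"
      using N u z(2) zH by (intro continuous_on_tendsto_compose[of "H1_real G" N]) (auto intro: H1_real_scale eventuallyI)
    moreover have "(\<lambda>n. weighted_l1 G ((1 / real n) *\<^sub>R z n)) \<longlonglongrightarrow> weighted_l1 G u"
      using z(2) by (intro continuous_on_tendsto_compose[OF continuous_on_weighted_l1[of UNIV]]) auto
    ultimately show ?thesis using LIMSEQ_unique by simp
  qed
  then show "N = ?N" using N by auto
qed

lemma stable_unit_ball_eq: "weighted_graph G \<Longrightarrow> stable_unit_ball G = l1_ball G"
  by (auto simp: stable_unit_ball_def l1_ball_def stable_norm_eq)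

theorem mainTheorem2:
  fixes G :: "('v::finite, 'e::finite) wgraph" and b :: nat
  assumes "weighted_graph G"
    and "betti1 G = b" and "b \<ge> 1"
  shows "polytope (stable_unit_ball G)
    \<and> aff_dim (stable_unit_ball G) = int b
    \<and> card {v. v extreme_point_of stable_unit_ball G} \<le> 2 * (2 ^ b - 1)"
  using assms polytope_l1_ball[of G] aff_dim_l1_ball[of G] card_extreme_points_l1_ball[of G]
  by (simp add: stable_unit_ball_eq)

end
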